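(* Let $N$ be a generic germ of smooth real submanifold of $\mathbb{P}^2(\mathbb{C})$, of dimension at most $3$ and of regularity $\mathcal{C}^2$. Then its dual $\check N\subset\check{\mathbb{P}}^2(\mathbb{C})$ is smooth of regularity $\mathcal{C}^1$ and satisfies $N=\check{\check N}$.
   Context: "Smooth" means nonsingular. $\check{\mathbb{P}}^2$ is the dual projective plane, whose points are the complex lines of $\mathbb{P}^2=\mathbb{P}^2(\mathbb{C})$. Let $X=\{(z,d)\in\mathbb{P}^2\times\check{\mathbb{P}}^2: z\in d\}=\mathbb{P}(T\mathbb{P}^2)$, with projections $p:X\to\mathbb{P}^2$ and $\pi:X\to\check{\mathbb{P}}^2$. For a smooth real submanifold $N\subset\mathbb{P}^2$ of dimension $\le3$ and regularity $\mathcal{C}^1$, the lift is $p^*N=\{(z,d)\in X: z\in N,\ T_zd+T_zN\neq T_z\mathbb{P}^2\}$, and the dual of $N$ is $\check N:=\pi(p^*N)$. Exchanging the roles of $\mathbb{P}^2$ and $\check{\mathbb{P}}^2$ (identifying $z\in\mathbb{P}^2$ with the line of $\check{\mathbb{P}}^2$ formed by the $d$ containing $z$), one defines similarly $\pi^*$ and the dual $p(\pi^*\check N)=\check{\check N}\subset\mathbb{P}^2$ of $\check N$. Genericity and germs: one fixes $(z_0,d_0)\in p^*N$, with $N$ a germ at $z_0$; $p^*N$ is considered as a germ at $(z_0,d_0)$, $\check N$ as a germ at $d_0$, and $\check{\check N}$ as a germ at $z_0$. "Generic" means that the germ of $p^*N$ at $(z_0,d_0)$ is a smooth $\mathcal{C}^1$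 submanifold which is transverse to the projection $\pi$, i.e. $\pi|_{p^*N}$ is an immersion at $(z_0,d_0)$. *)

theory Defs
  imports "HOL-Analysis.Analysis"
begin

section \<open>Real submanifolds of Euclidean spaces\<close>

text \<open>
  Maps of class \<open>C\<^sup>r\<close> on an open set \<open>S\<close>. The derivative is taken over the reals; in finite
  dimension, \<open>C\<^sup>r\<close> regularity of the derivative is the same as \<open>C\<^sup>r\<close> regularity of all the
  directional derivatives, which keeps the type of the map fixed along the recursion.
\<close>

primrec Ck_on :: "nat \<Rightarrow> ('a::euclidean_space \<Rightarrow> 'b::euclidean_space) \<Rightarrow> 'a set \<Rightarrow> bool" where
  "Ck_on 0 f S \<longleftrightarrow> continuous_on S f"
| "Ck_on (Suc r) f S \<longleftrightarrow>
     (\<forall>x\<in>S. f differentiable (at x)) \<and> (\<forall>v. Ck_on r (\<lambda>x. frechet_derivative f (at x) v) S)"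

definition Ck_diffeo ::
    "nat \<Rightarrow> 'a::euclidean_space set \<Rightarrow> 'a set \<Rightarrow> ('a \<Rightarrow> 'a) \<Rightarrow> ('a \<Rightarrow> 'a) \<Rightarrow> bool" where
  "Ck_diffeo r U V \<Phi> \<Psi> \<longleftrightarrow>
     open U \<and> open V \<and> homeomorphism U V \<Phi> \<Psi> \<and> Ck_on r \<Phi> U \<and> Ck_on r \<Psi> V"

text \<open>
  Near \<open>x\<close>, the set \<open>S\<close> is an embedded \<open>C\<^sup>r\<close> submanifold of real dimension \<open>k\<close>: a local
  \<open>C\<^sup>r\<close> diffeomorphism of the ambient space carries it to a \<open>k\<close>-dimensional real linear subspace.
\<close>

definition eucl_submanifold_at :: "nat \<Rightarrow> nat \<Rightarrow> 'a::euclidean_space set \<Rightarrow> 'a \<Rightarrow> bool" where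
  "eucl_submanifold_at r k S x \<longleftrightarrow>
     x \<in> S \<and> (\<exists>U V \<Phi> \<Psi> L. x \<in> U \<and> Ck_diffeo r U V \<Phi> \<Psi> \<and> subspace L \<and> dim L = k \<and>
       \<Phi> ` (S \<inter> U) = V \<inter> L)"

text \<open>Velocities at \<open>x\<close> of curves in \<open>S\<close>; for a \<open>C\<^sup>1\<close> submanifold this is its tangent space.\<close>

definition eucl_tangent :: "'a::euclidean_space set \<Rightarrow> 'a \<Rightarrow> 'a set" where
  "eucl_tangent S x =
     {v. \<exists>\<gamma>. \<gamma> 0 = x \<and> (\<forall>\<^sub>F t in nhds (0::real). \<gamma> t \<in> S) \<and> (\<gamma> has_vector_derivative v) (at 0)}"


section \<open>Real submanifolds of a manifold given by an atlas\<close>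

text \<open>A chart is a pair of an open domain and a coordinate map.\<close>

type_synonym ('m, 'e) chart = "'m set \<times> ('m \<Rightarrow> 'e)"

definition prod_atlas :: "('m, 'e) chart set \<Rightarrow> ('n, 'f) chart set \<Rightarrow> ('m \<times> 'n, 'e \<times> 'f) chart set"
  where "prod_atlas A B = {(U \<times> V, map_prod \<phi> \<psi>) | U \<phi> V \<psi>. (U, \<phi>) \<in> A \<and> (V, \<psi>) \<in> B}"

definition submanifold_at ::
    "('m, 'e::euclidean_space) chart set \<Rightarrow> nat \<Rightarrow> nat \<Rightarrow> 'm set \<Rightarrow> 'm \<Rightarrow> bool" where
  "submanifold_at A r k S x \<longleftrightarrow>
     (\<exists>(U, \<phi>)\<in>A. x \<in> U \<and> eucl_submanifold_at r k (\<phi> ` (S \<inter> U)) (\<phi> x))"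

text \<open>The tangent space of \<open>S\<close> at \<open>x\<close>, read in a chart around \<open>x\<close>.\<close>

definition tangent_in :: "('m, 'e::euclidean_space) chart \<Rightarrow> 'm set \<Rightarrow> 'm \<Rightarrow> 'e set" where
  "tangent_in c S x = eucl_tangent (snd c ` (S \<inter> fst c)) (snd c x)"


section \<open>Germs of sets\<close>

definition germ_eq :: "'a::topological_space \<Rightarrow> 'a set \<Rightarrow> 'a set \<Rightarrow> bool" where
  "germ_eq x S T \<longleftrightarrow> (\<exists>U. open U \<and> x \<in> U \<and> S \<inter> U = T \<inter> U)"

text \<open>
  The image under \<open>f\<close> of the germ of \<open>S\<close> at \<open>x\<close> is the germ of \<open>T\<close> at \<open>f x\<close>: the image of every
  sufficiently small representative of the former represents the latter.
\<close>

definition germ_image ::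
    "('a::topological_space \<Rightarrow> 'b::topological_space) \<Rightarrow> 'a set \<Rightarrow> 'a \<Rightarrow> 'b set \<Rightarrow> bool" where
  "germ_image f S x T \<longleftrightarrow>
     (\<exists>W0. open W0 \<and> x \<in> W0 \<and>
       (\<forall>W. open W \<and> x \<in> W \<and> W \<subseteq> W0 \<longrightarrow> germ_eq (f x) (f ` (S \<inter> W)) T))"

lemma germ_eq_sym: "germ_eq x S T \<Longrightarrow> germ_eq x T S"
  unfolding germ_eq_def by metis

lemma germ_eq_trans:
  assumes "germ_eq x S T" "germ_eq x T R"
  shows "germ_eq x S R"
proof -
  obtain U V where "open U" "x \<in> U" "S \<inter> U = T \<inter> U" "open V" "x \<in> V" "T \<inter> V = R \<inter> V"
    using assms unfolding germ_eq_def by metis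
  then have "open (U \<inter> V)" "x \<in> U \<inter> V" "S \<inter> (U \<inter> V) = R \<inter> (U \<inter> V)"
    by blast+
  then show ?thesis unfolding germ_eq_def by blast
qed

lemma germ_image_unique:
  assumes "germ_image f S x T" "germ_image f S x T'"
  shows "germ_eq (f x) T T'"
proof -
  obtain W0 W1 where
    "open W0" "x \<in> W0"
    "\<And>W. open W \<Longrightarrow> x \<in> W \<Longrightarrow> W \<subseteq> W0 \<Longrightarrow> germ_eq (f x) (f ` (S \<inter> W)) T"
    "open W1" "x \<in> W1"
    "\<And>W. open W \<Longrightarrow> x \<in> W \<Longrightarrow> W \<subseteq> W1 \<Longrightarrow> germ_eq (f x) (f ` (S \<inter> W)) T'"
    using assms unfolding germ_image_def by metis
  then have "germ_eq (f x) (f ` (S \<inter> (W0 \<inter> W1))) T" "germ_eq (f x) (f ` (S \<inter> (W0 \<inter> W1))) T'"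
    by (simp_all add: open_Int le_infI1 le_infI2)
  then show ?thesis by (blast intro: germ_eq_sym germ_eq_trans)
qed


section \<open>The complex projective plane and its dual\<close>

quotient_type cp2 = "complex^3" / partial:
  "\<lambda>v w. v \<noteq> 0 \<and> w \<noteq> 0 \<and> (\<exists>c. w = c *s v)"
proof (rule part_equivpI)
  show "\<exists>v::complex^3. v \<noteq> 0 \<and> v \<noteq> 0 \<and> (\<exists>c. v = c *s v)"
    by (rule exI[of _ "vec 1"], auto simp: vec_eq_iff intro: exI[of _ 1])
  show "symp (\<lambda>v w::complex^3. v \<noteq> 0 \<and> w \<noteq> 0 \<and> (\<exists>c. w = c *s v))"
  proof (rule sympI)
    fix v w :: "complex^3"
    assume vw: "v \<noteq> 0 \<and> w \<noteq> 0 \<and> (\<exists>c. w = c *s v)"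
    then obtain c where "w = c *s v" by blast
    with vw have "v = inverse c *s w" by (auto simp: vector_smult_assoc)
    with vw show "w \<noteq> 0 \<and> v \<noteq> 0 \<and> (\<exists>c. v = c *s w)" by blast
  qed
  show "transp (\<lambda>v w::complex^3. v \<noteq> 0 \<and> w \<noteq> 0 \<and> (\<exists>c. w = c *s v))"
    by (rule transpI) (use vector_smult_assoc in blast)
qed

instantiation cp2 :: topological_space
begin

definition open_cp2 :: "cp2 set \<Rightarrow> bool" where
  "open_cp2 U \<longleftrightarrow> open {v. v \<noteq> 0 \<and> abs_cp2 v \<in> U}"

instance
proof
  have "{v::complex^3. v \<noteq> 0 \<and> abs_cp2 v \<in> UNIV} = - {0}" by auto
  then show "open (UNIV :: cp2 set)" unfolding open_cp2_def by (simp add: open_Compl)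
next
  fix S T :: "cp2 set" assume "open S" "open T"
  moreover have "{v. v \<noteq> 0 \<and> abs_cp2 v \<in> S \<inter> T} =
      {v. v \<noteq> 0 \<and> abs_cp2 v \<in> S} \<inter> {v. v \<noteq> 0 \<and> abs_cp2 v \<in> T}" by auto
  ultimately show "open (S \<inter> T)" unfolding open_cp2_def by auto
next
  fix K :: "cp2 set set" assume "\<forall>S\<in>K. open S"
  moreover have "{v. v \<noteq> 0 \<and> abs_cp2 v \<in> \<Union>K} = (\<Union>S\<in>K. {v. v \<noteq> 0 \<and> abs_cp2 v \<in> S})" by auto
  ultimately show "open (\<Union>K)" unfolding open_cp2_def by auto
qed

end

text \<open>
  The three affine charts: the coordinate \<open>i\<close> is normalised to 1. The indices live in the
  cyclic type \<open>3\<close>, so that \<open>i\<close>, \<open>i + 1\<close>, \<open>i + 2\<close> are always the three coordinates.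
\<close>

lift_definition affine_dom :: "3 \<Rightarrow> cp2 \<Rightarrow> bool" is "\<lambda>i v. v $ i \<noteq> 0"
  by (auto simp: vec_eq_iff)

lift_definition affine_coord :: "3 \<Rightarrow> cp2 \<Rightarrow> complex \<times> complex" is
  "\<lambda>i v. (v $ (i + 1) / v $ i, v $ (i + 2) / v $ i)"
  by (auto simp: vec_eq_iff)

definition cp2_atlas :: "(cp2, complex \<times> complex) chart set" where
  "cp2_atlas = {({z. affine_dom i z}, affine_coord i) | i. True}"

text \<open>
  The points of the dual plane are the complex lines of the plane. The line with equation
  \<open>a\<^sub>1 x\<^sub>1 + a\<^sub>2 x\<^sub>2 + a\<^sub>3 x\<^sub>3 = 0\<close> is represented by its homogeneous coefficients
  \<open>[a\<^sub>1 : a\<^sub>2 : a\<^sub>3]\<close>, hence the dual plane has the type \<open>cp2\<close> as well. Since the equation is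
  symmetric in coefficients and coordinates, \<open>line z\<close> is then also the set of all lines
  containing the point \<open>z\<close>, so everything below applies verbatim with the roles of the plane
  and of its dual exchanged.
\<close>

lift_definition incident :: "cp2 \<Rightarrow> cp2 \<Rightarrow> bool" is "\<lambda>v a. (\<Sum>i\<in>UNIV. a $ i * v $ i) = 0"
proof -
  fix v w a b :: "complex^3"
  assume "v \<noteq> 0 \<and> w \<noteq> 0 \<and> (\<exists>c. w = c *s v)" "a \<noteq> 0 \<and> b \<noteq> 0 \<and> (\<exists>c. b = c *s a)"
  then obtain c e where "w = c *s v" "b = e *s a" and "w \<noteq> 0" "b \<noteq> 0" by blast
  then have "(\<Sum>i\<in>UNIV. b $ i * w $ i) = (e * c) * (\<Sum>i\<in>UNIV. a $ i * v $ i)" "c \<noteq> 0" "e \<noteq> 0"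
    by (auto simp: sum_distrib_left mult_ac intro!: sum.cong)
  then show "((\<Sum>i\<in>UNIV. a $ i * v $ i) = 0) = ((\<Sum>i\<in>UNIV. b $ i * w $ i) = 0)"
    by simp
qed

definition line :: "cp2 \<Rightarrow> cp2 set" where
  "line d = {z. incident z d}"

lemma incident_commute: "incident z d \<longleftrightarrow> incident d z"
  by transfer (simp add: mult.commute)

lemma line_inject: "line d = line e \<longleftrightarrow> d = e"
proof
  assume "line d = line e"
  then have "\<forall>z. incident z d \<longleftrightarrow> incident z e" by (auto simp: line_def)
  then show "d = e"
  proof transfer
    fix a b :: "complex^3"
    assume "a \<noteq> 0 \<and> a \<noteq> 0 \<and> (\<exists>c. a = c *s a)" "b \<noteq> 0 \<and> b \<noteq> 0 \<and> (\<exists>c. b = c *s b)"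
    then have nz: "a \<noteq> 0" "b \<noteq> 0" by auto
    assume same: "\<forall>v\<in>{v. v \<noteq> 0 \<and> v \<noteq> 0 \<and> (\<exists>c. v = c *s v)}.
      ((\<Sum>i\<in>UNIV. a $ i * v $ i) = 0) = ((\<Sum>i\<in>UNIV. b $ i * v $ i) = 0)"
    have zero: "(\<Sum>i\<in>UNIV. b $ i * v $ i) = 0" if "(\<Sum>i\<in>UNIV. a $ i * v $ i) = 0" for v :: "complex^3"
    proof (cases "v = 0")
      case False
      have "v = 1 *s v" by simp
      with False have "v \<in> {v. v \<noteq> 0 \<and> v \<noteq> 0 \<and> (\<exists>c. v = c *s v)}"
        by blast
      with same that show ?thesis by blast
    qed simp
    have 1: "b $ 1 * a $ 2 = b $ 2 * a $ 1"
      using zero[of "vector [a $ 2, - a $ 1, 0]"] by (simp add: sum_3)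
    have 2: "b $ 1 * a $ 3 = b $ 3 * a $ 1"
      using zero[of "vector [a $ 3, 0, - a $ 1]"] by (simp add: sum_3)
    have 3: "b $ 2 * a $ 3 = b $ 3 * a $ 2"
      using zero[of "vector [0, a $ 3, - a $ 2]"] by (simp add: sum_3)
    obtain k where k: "a $ k \<noteq> 0" using nz(1) by (auto simp: vec_eq_iff)
    have "b $ i * a $ k = b $ k * a $ i" for i
      using exhaust_3[of i] exhaust_3[of k] 1 2 3 by auto
    then have "b = (b $ k / a $ k) *s a"
      using k by (simp add: vec_eq_iff field_simps)
    then show "a \<noteq> 0 \<and> b \<noteq> 0 \<and> (\<exists>c. b = c *s a)" using nz by blast
  qed
qed simp

definition flag_variety :: "(cp2 \<times> cp2) set" where
  "flag_variety = {(z, d). z \<in> line d}"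


section \<open>Lift and dual\<close>

text \<open>
  The condition \<open>T\<^sub>z d + T\<^sub>z N \<noteq> T\<^sub>z P\<^sup>2\<close> is read in an affine chart around \<open>z\<close>; it does not depend
  on that chart.
\<close>

definition lift :: "cp2 set \<Rightarrow> (cp2 \<times> cp2) set" where
  "lift N = {(z, d) \<in> flag_variety. z \<in> N \<and>
     (\<exists>c\<in>cp2_atlas. z \<in> fst c \<and>
        {u + v | u v. u \<in> tangent_in c (line d) z \<and> v \<in> tangent_in c N z} \<noteq> tangent_in c UNIV z)}"

text \<open>
  Genericity at \<open>(z, d)\<close>. Being a \<open>C\<^sup>1\<close> submanifold of the flag variety (itself a closed
  submanifold of the product) amounts to being a \<open>C\<^sup>1\<close> submanifold of the product. In product
  charts the projection to the dual plane is \<open>snd\<close>, and so is its differential.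
\<close>

definition generic_at :: "cp2 set \<Rightarrow> cp2 \<Rightarrow> cp2 \<Rightarrow> bool" where
  "generic_at N z d \<longleftrightarrow>
     (\<exists>j. submanifold_at (prod_atlas cp2_atlas cp2_atlas) 1 j (lift N) (z, d)) \<and>
     (\<exists>c\<in>prod_atlas cp2_atlas cp2_atlas. (z, d) \<in> fst c \<and> inj_on snd (tangent_in c (lift N) (z, d)))"

text \<open>\<open>M\<close> represents, as a germ at \<open>d\<close>, the dual of \<open>N\<close>, where the lift is a germ at \<open>(z, d)\<close>.\<close>

definition is_dual_germ :: "cp2 set \<Rightarrow> cp2 \<Rightarrow> cp2 \<Rightarrow> cp2 set \<Rightarrow> bool" where
  "is_dual_germ N z d M \<longleftrightarrow> germ_image snd (lift N) (z, d) M"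

lemma is_dual_germ_unique: "is_dual_germ N z d M \<Longrightarrow> is_dual_germ N z d M' \<Longrightarrow> germ_eq d M M'"
  unfolding is_dual_germ_def using germ_image_unique[of snd "lift N" "(z, d)" M M'] by simp

end

theory Submission
  imports Defs
begin

text \<open>
  Why the theorem is true. Let \<open>P\<close> be the lift of \<open>N\<close>, inside the variety of flags \<open>(z, d)\<close>. Write
  points and lines by homogeneous vectors, with the incidence relation \<open>pairing v a = 0\<close>.
  Differentiating it gives, for a tangent vector of \<open>P\<close> with components \<open>w\<close> (motion of the point)
  and \<open>u\<close> (motion of the line), that the line pairs with \<open>w\<close> to minus what the point pairs with \<open>u\<close>
  (lemma \<open>contact_relation\<close>): the two projections of the flag variety define the same contact structure. A pair \<open>(z, d)\<close>
  lies in \<open>P\<close> exactly when some homogeneous vector \<open>a\<close> of \<open>d\<close> is conormal, that is, has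
  \<open>Re (pairing w a) = 0\<close> for all tangent vectors \<open>w\<close> of \<open>N\<close> (lemma \<open>lift_iff_conormal\<close>). By the contact relation the
  point \<open>z\<close>, multiplied by the same scalar, is then conormal to the projection \<open>M\<close> of \<open>P\<close>. Hence
  \<open>(d, z)\<close> lies in the lift of \<open>M\<close> (lemma \<open>lift_swap\<close>).

  Genericity makes \<open>M\<close> a \<open>C\<^sup>1\<close> submanifold with tangent space \<open>snd ` T P\<close>, by the inverse function
  theorem (lemma \<open>immersed_projection\<close>). It remains to see that \<open>z\<close> is the only point over \<open>d\<close> in the lift of \<open>M\<close>,
  and for this it suffices that the tangent space \<open>S\<close> of \<open>M\<close> contains the complex line \<open>K\<close> of those
  \<open>u\<close> that pair to \<open>0\<close> with \<open>z\<close>: a complex functional whose real part vanishes on \<open>K\<close> vanishes on \<open>K\<close>, so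
  it is proportional to that of \<open>z\<close> (lemma \<open>unique_lift_point\<close>).

  The space \<open>S\<close> lies in the real hyperplane defined by the conormal covector, and \<open>K\<close> lies in the same
  hyperplane. So \<open>K \<subseteq> S\<close> is clear when \<open>dim S = 3\<close>. Otherwise a rank computation is used (lemma \<open>lift_rank\<close>).
  A diffeomorphism that flattens \<open>N\<close> to a subspace \<open>L\<close> parametrizes \<open>P\<close> near \<open>(z, d)\<close> by points
  of \<open>L\<close> and covectors orthogonal to \<open>L\<close>, which together are \<open>4\<close> real parameters. The kernel of the
  differential consists of the conormal covectors that are complex multiples of a given one, so it has
  dimension at most \<open>2\<close>, and the rank is at least \<open>2\<close>. If \<open>dim P = 2\<close>, then all complex multiples are
  conormal, so the line \<open>d\<close> pairs to \<open>0\<close> with every tangent vector of \<open>N\<close>, not only in its real part.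
  By the contact relation \<open>S \<subseteq> K\<close>, and \<open>S = K\<close> by dimension. This treats alike all dimensions of \<open>N\<close> and
  its totally real and complex points.

  Finally, flattening extends a conormal covector continuously along \<open>N\<close> (lemma \<open>lift_section\<close>), so that every
  point of \<open>N\<close> near \<open>z\<close> is seen by the lift near \<open>(z, d)\<close>, and the bidual is all of \<open>N\<close>. The \<open>C\<^sup>2\<close>
  regularity of \<open>N\<close> enters because the conormal covectors involve the derivative of the flattening.
\<close>

section \<open>Tangent spaces of subsets of Euclidean spaces\<close>

lemma eucl_tangent_image_subset:
  assumes g: "(g has_derivative g') (at x)" and W: "open W" "x \<in> W" "g ` (S \<inter> W) \<subseteq> S'"
  shows "g' ` eucl_tangent S x \<subseteq> eucl_tangent S' (g x)"
proof
  fix w assume "w \<in> g' ` eucl_tangent S x"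
  then obtain v \<gamma> where w: "w = g' v" and \<gamma>: "\<gamma> 0 = x" "\<forall>\<^sub>F t in nhds (0::real). \<gamma> t \<in> S"
    "(\<gamma> has_vector_derivative v) (at 0)"
    by (auto simp: eucl_tangent_def)
  have "isCont \<gamma> 0" using \<gamma>(3) by (rule has_vector_derivative_continuous)
  then have "(\<gamma> \<longlongrightarrow> \<gamma> 0) (nhds 0)" by (simp add: isCont_def tendsto_at_iff_tendsto_nhds)
  with W \<gamma>(1) have "\<forall>\<^sub>F t in nhds 0. \<gamma> t \<in> W" by (auto dest: topological_tendstoD)
  with \<gamma>(2) have "\<forall>\<^sub>F t in nhds 0. g (\<gamma> t) \<in> S'"
    by eventually_elim (use W in blast)
  moreover have "(g \<circ> \<gamma> has_vector_derivative w) (at 0)"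
    unfolding has_vector_derivative_def w
    using diff_chain_at[OF \<gamma>(3)[unfolded has_vector_derivative_def], of g g'] g \<gamma>(1)
      linear_cmul[OF has_derivative_linear[OF g]] by (simp add: o_def)
  ultimately show "w \<in> eucl_tangent S' (g x)"
    unfolding eucl_tangent_def using \<gamma>(1) by (auto intro!: exI[of _ "g \<circ> \<gamma>"])
qed

lemma eucl_tangent_nonempty: "v \<in> eucl_tangent S x \<Longrightarrow> x \<in> S"
  unfolding eucl_tangent_def by (auto dest: eventually_nhds_x_imp_x)

lemma has_derivative_inverse_pair:
  assumes g: "(g has_derivative g') (at x)" and h: "(h has_derivative h') (at (g x))"
    and W: "open W" "x \<in> W" "\<And>y. y \<in> W \<Longrightarrow> h (g y) = y"
  shows "h' (g' v) = v"
proof -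
  have "(h \<circ> g has_derivative h' \<circ> g') (at x)" by (rule diff_chain_at[OF g h])
  then have "((\<lambda>y. y) has_derivative h' \<circ> g') (at x)"
    by (rule has_derivative_transform_within_open[OF _ W(1,2)]) (use W(3) in auto)
  then have "h' \<circ> g' = (\<lambda>y. y)" using has_derivative_unique has_derivative_ident by blast
  then show ?thesis by (metis comp_apply)
qed

text \<open>
  Tangent spaces transform under maps that are inverse to each other near a point and match the
  sets there. Only differentiability at the two points is required, so that chart changes can be
  treated without any submanifold structure on the set.
\<close>

lemma eucl_tangent_local_diffeo:
  assumes g: "(g has_derivative g') (at x)" and h: "(h has_derivative h') (at (g x))"
    and W: "open W" "x \<in> W" "\<And>y. y \<in> W \<Longrightarrow> h (g y) = y" "g ` (S \<inter> W) \<subseteq> S'"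
    and W': "open W'" "g x \<in> W'" "\<And>y. y \<in> W' \<Longrightarrow> g (h y) = y" "h ` (S' \<inter> W') \<subseteq> S"
  shows "eucl_tangent S' (g x) = g' ` eucl_tangent S x"
proof
  show "g' ` eucl_tangent S x \<subseteq> eucl_tangent S' (g x)"
    by (rule eucl_tangent_image_subset[OF g W(1,2,4)])
  have hx: "h (g x) = x" using W by blast
  have "h' ` eucl_tangent S' (g x) \<subseteq> eucl_tangent S x"
    using eucl_tangent_image_subset[OF h W'(1,2,4)] hx by simp
  moreover have "g' (h' v) = v" for v
    using has_derivative_inverse_pair[OF h, of g g' W'] g hx W' by simp
  ultimately show "eucl_tangent S' (g x) \<subseteq> g' ` eucl_tangent S x"
    by (metis image_mono image_subset_iff imageI subsetI)
qed

lemma eucl_tangent_subspace: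
  assumes L: "subspace L" and V: "open V" "y \<in> V" "y \<in> L"
  shows "eucl_tangent (V \<inter> L) y = L"
proof
  show "L \<subseteq> eucl_tangent (V \<inter> L) y"
  proof
    fix v assume v: "v \<in> L"
    let ?\<gamma> = "\<lambda>t. y + t *\<^sub>R v"
    have "((\<lambda>t. y + t *\<^sub>R v) \<longlongrightarrow> y + 0 *\<^sub>R v) (nhds 0)" by (intro tendsto_intros) (simp add: filterlim_ident)
    with V have "\<forall>\<^sub>F t in nhds 0. ?\<gamma> t \<in> V" by (auto dest: topological_tendstoD)
    then have "\<forall>\<^sub>F t in nhds 0. ?\<gamma> t \<in> V \<inter> L"
      by eventually_elim (use L V v in \<open>auto intro: subspace_add subspace_mul\<close>)
    moreover have "(?\<gamma> has_vector_derivative v) (at 0)"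
      unfolding has_vector_derivative_def by (auto intro!: derivative_eq_intros)
    ultimately show "v \<in> eucl_tangent (V \<inter> L) y"
      unfolding eucl_tangent_def by (auto intro!: exI[of _ ?\<gamma>])
  qed
  show "eucl_tangent (V \<inter> L) y \<subseteq> L"
  proof
    fix v assume "v \<in> eucl_tangent (V \<inter> L) y"
    then obtain \<gamma> where \<gamma>: "\<gamma> 0 = y" "\<forall>\<^sub>F t in nhds (0::real). \<gamma> t \<in> V \<inter> L"
      "(\<gamma> has_vector_derivative v) (at 0)"
      by (auto simp: eucl_tangent_def)
    have "((\<lambda>t. norm (\<gamma> t - \<gamma> 0 - t *\<^sub>R v) / norm t) \<longlongrightarrow> 0) (at 0)"
      using \<gamma>(3) by (simp add: has_vector_derivative_def has_derivative_at)
    moreover have "\<forall>\<^sub>F t in at 0. norm (\<gamma> t - \<gamma> 0 - t *\<^sub>R v) / norm t = norm ((\<gamma> t - \<gamma> 0) /\<^sub>R t - v)"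
    proof (rule eventually_at_topological[THEN iffD2], intro exI[of _ UNIV] conjI ballI impI)
      fix t :: real assume "t \<noteq> 0"
      then have "(\<gamma> t - \<gamma> 0) /\<^sub>R t - v = (\<gamma> t - \<gamma> 0 - t *\<^sub>R v) /\<^sub>R t"
        by (simp add: algebra_simps)
      then show "norm (\<gamma> t - \<gamma> 0 - t *\<^sub>R v) / norm t = norm ((\<gamma> t - \<gamma> 0) /\<^sub>R t - v)"
        by (simp add: divide_inverse_commute)
    qed auto
    ultimately have "((\<lambda>t. norm ((\<gamma> t - \<gamma> 0) /\<^sub>R t - v)) \<longlongrightarrow> 0) (at 0)"
      by (rule Lim_transform_eventually)
    then have "((\<lambda>t. (\<gamma> t - \<gamma> 0) /\<^sub>R t) \<longlongrightarrow> v) (at 0)"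
      by (metis LIM_zero_cancel tendsto_norm_zero_cancel)
    moreover have "\<forall>\<^sub>F t in at 0. (\<gamma> t - \<gamma> 0) /\<^sub>R t \<in> L"
    proof -
      have "\<forall>\<^sub>F t in at 0. \<gamma> t \<in> V \<inter> L" using \<gamma>(2) by (simp add: eventually_nhds_conv_at)
      then show ?thesis
        by eventually_elim (use L V \<gamma>(1) in \<open>auto intro: subspace_diff subspace_mul\<close>)
    qed
    ultimately show "v \<in> L"
      by (rule Lim_in_closed_set[OF closed_subspace[OF L], rotated 2]) simp_all
  qed
qed

text \<open>The data by which \<^const>\<open>eucl_submanifold_at\<close> exhibits a submanifold, with names.\<close>

definition flattens ::
    "nat \<Rightarrow> 'a::euclidean_space set \<Rightarrow> 'a set \<Rightarrow> 'a set \<Rightarrow> ('a \<Rightarrow> 'a) \<Rightarrow> ('a \<Rightarrow> 'a) \<Rightarrow> 'a set \<Rightarrow> bool"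
  where "flattens r S U V \<Phi> \<Psi> L \<longleftrightarrow>
    Ck_diffeo r U V \<Phi> \<Psi> \<and> subspace L \<and> \<Phi> ` (S \<inter> U) = V \<inter> L"

lemma eucl_submanifold_at_flattens:
  "eucl_submanifold_at r k S x \<longleftrightarrow>
    x \<in> S \<and> (\<exists>U V \<Phi> \<Psi> L. x \<in> U \<and> flattens r S U V \<Phi> \<Psi> L \<and> dim L = k)"
  unfolding eucl_submanifold_at_def flattens_def by (auto; blast)

lemma flattensD:
  assumes "flattens r S U V \<Phi> \<Psi> L"
  shows "open U" "open V" "subspace L" "homeomorphism U V \<Phi> \<Psi>"
    "Ck_on r \<Phi> U" "Ck_on r \<Psi> V" "\<Phi> ` (S \<inter> U) = V \<inter> L"
    "\<And>y. y \<in> U \<Longrightarrow> \<Phi> y \<in> V" "\<And>x. x \<in> V \<Longrightarrow> \<Psi> x \<in> U"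
    "\<And>y. y \<in> U \<Longrightarrow> \<Psi> (\<Phi> y) = y" "\<And>x. x \<in> V \<Longrightarrow> \<Phi> (\<Psi> x) = x"
    "\<And>y. y \<in> U \<Longrightarrow> \<Phi> y \<in> L \<longleftrightarrow> y \<in> S"
    "\<And>x. x \<in> V \<Longrightarrow> \<Psi> x \<in> S \<longleftrightarrow> x \<in> L"
proof -
  show *: "open U" "open V" "subspace L" "homeomorphism U V \<Phi> \<Psi>"
    "Ck_on r \<Phi> U" "Ck_on r \<Psi> V" and im: "\<Phi> ` (S \<inter> U) = V \<inter> L"
    using assms by (auto simp: flattens_def Ck_diffeo_def)
  show **: "\<And>y. y \<in> U \<Longrightarrow> \<Phi> y \<in> V" "\<And>x. x \<in> V \<Longrightarrow> \<Psi> x \<in> U"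
    "\<And>y. y \<in> U \<Longrightarrow> \<Psi> (\<Phi> y) = y" "\<And>x. x \<in> V \<Longrightarrow> \<Phi> (\<Psi> x) = x"
    using *(4) unfolding homeomorphism_def by auto
  show "\<Phi> y \<in> L \<longleftrightarrow> y \<in> S" if y: "y \<in> U" for y
  proof
    assume "\<Phi> y \<in> L"
    then obtain y' where "y' \<in> S \<inter> U" "\<Phi> y' = \<Phi> y" using **(1) y im by (metis Int_iff imageE)
    then show "y \<in> S" using **(3) y by (metis Int_iff)
  qed (use im y in blast)
  then show "\<Psi> x \<in> S \<longleftrightarrow> x \<in> L" if "x \<in> V" for x
    using that ** by metis
qed

lemma flattens_derivs:
  assumes "flattens (Suc r) S U V \<Phi> \<Psi> L" "x \<in> U"
  defines "\<Phi>' \<equiv> frechet_derivative \<Phi> (at x)" and "\<Psi>' \<equiv> frechet_derivative \<Psi> (at (\<Phi> x))"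
  shows "(\<Phi> has_derivative \<Phi>') (at x)" "(\<Psi> has_derivative \<Psi>') (at (\<Phi> x))"
    "\<And>v. \<Psi>' (\<Phi>' v) = v" "\<And>v. \<Phi>' (\<Psi>' v) = v"
proof -
  note f = flattensD[OF assms(1)]
  show 1: "(\<Phi> has_derivative \<Phi>') (at x)" "(\<Psi> has_derivative \<Psi>') (at (\<Phi> x))"
    using f(5,6,8) assms(2) by (auto simp: \<Phi>'_def \<Psi>'_def frechet_derivative_works[symmetric])
  show "\<Psi>' (\<Phi>' v) = v" for v
    by (rule has_derivative_inverse_pair[OF 1 f(1) assms(2)]) (use f in auto)
  have "(\<Phi> has_derivative \<Phi>') (at (\<Psi> (\<Phi> x)))" using 1 assms(2) f(10) by simp
  then show "\<Phi>' (\<Psi>' v) = v" for v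
    by (rule has_derivative_inverse_pair[OF 1(2) _ f(2)]) (use f assms(2) in auto)
qed

lemma flattens_tangent:
  assumes fl: "flattens (Suc r) S U V \<Phi> \<Psi> L" and x: "x \<in> S" "x \<in> U"
  shows "eucl_tangent S x = frechet_derivative \<Psi> (at (\<Phi> x)) ` L"
    "subspace (eucl_tangent S x)" "dim (eucl_tangent S x) = dim L"
proof -
  note f = flattensD[OF fl] and d = flattens_derivs[OF fl x(2)]
  have "eucl_tangent S (\<Psi> (\<Phi> x)) = frechet_derivative \<Psi> (at (\<Phi> x)) ` eucl_tangent (V \<inter> L) (\<Phi> x)"
    by (rule eucl_tangent_local_diffeo[where h = \<Phi> and W = V and W' = U, OF d(2)])
      (use d(1) f x in auto)
  also have "eucl_tangent (V \<inter> L) (\<Phi> x) = L"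
    by (rule eucl_tangent_subspace) (use f x in auto)
  finally show eq: "eucl_tangent S x = frechet_derivative \<Psi> (at (\<Phi> x)) ` L" using f(10) x by simp
  have lin: "linear (frechet_derivative \<Psi> (at (\<Phi> x)))" using d(2) has_derivative_linear by blast
  show "subspace (eucl_tangent S x)" unfolding eq by (rule linear_subspace_image[OF lin f(3)])
  show "dim (eucl_tangent S x) = dim L" unfolding eq
    by (rule dim_image_eq[OF lin]) (metis d(4) inj_on_inverseI)
qed

section \<open>Images of submanifolds under a projection\<close>

lemma Ck_on_1_iff:
  "Ck_on 1 f S \<longleftrightarrow> (\<forall>x\<in>S. f differentiable (at x)) \<and>
    (\<forall>v. continuous_on S (\<lambda>x. frechet_derivative f (at x) v))"
  by (simp flip: One_nat_def[symmetric] add: One_nat_def)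

text \<open>
  A linear isomorphism stays bounded below by a fixed constant under small perturbations, and
  \<open>B y (u y - u y0) = (B y0 - B y) (u y0)\<close> for \<open>u y = inv (B y) v\<close>.
\<close>

lemma continuous_on_inv_blinfun:
  fixes B :: "'b::t2_space \<Rightarrow> 'a::euclidean_space \<Rightarrow>\<^sub>L 'a"
  assumes cont: "continuous_on S B" and bij: "\<And>y. y \<in> S \<Longrightarrow> bij (blinfun_apply (B y))"
  shows "continuous_on S (\<lambda>y. inv (blinfun_apply (B y)) v)"
proof (unfold continuous_on_def, intro ballI)
  fix y0 assume y0: "y0 \<in> S"
  let ?u = "\<lambda>y. inv (blinfun_apply (B y)) v"
  let ?F = "at y0 within S"
  have Bu: "B y (?u y) = v" if "y \<in> S" for y
    using bij[OF that] by (simp add: bij_is_surj surj_f_inv_f)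
  obtain c where c: "c > 0" "\<And>h. c * norm h \<le> norm (B y0 h)"
    using linear_inj_bounded_below_pos[of "blinfun_apply (B y0)"] bij[OF y0]
    by (metis bij_is_inj blinfun.bounded_linear_right bounded_linear.linear)
  have lim: "((\<lambda>y. norm (B y0 - B y)) \<longlongrightarrow> 0) ?F"
    using tendsto_norm[OF tendsto_diff[OF tendsto_const[of "B y0"], of B "B y0" ?F]] cont y0
    by (simp add: continuous_on_def)
  have "\<forall>\<^sub>F y in ?F. norm (?u y - ?u y0) \<le> norm (B y0 - B y) * (2 * norm (?u y0) / c)"
  proof -
    have "\<forall>\<^sub>F y in ?F. norm (B y0 - B y) < c / 2" using lim c(1) by (intro order_tendstoD) auto
    moreover have "\<forall>\<^sub>F y in ?F. y \<in> S" by (simp add: eventually_at_filter)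
    ultimately show ?thesis
    proof eventually_elim
      case (elim y)
      let ?h = "?u y - ?u y0" and ?e = "norm (B y0 - B y)"
      have "B y ?h = (B y0 - B y) (?u y0)"
        using Bu[OF y0] Bu[OF elim(2)] by (simp add: blinfun.diff_right blinfun.diff_left)
      then have "B y0 ?h = (B y0 - B y) (?u y0) + (B y0 - B y) ?h"
        by (simp add: blinfun.diff_left)
      then have "norm (B y0 ?h) \<le> ?e * norm (?u y0) + ?e * norm ?h"
        by (metis norm_blinfun norm_triangle_mono)
      with c(2)[of ?h] have "c * norm ?h \<le> ?e * norm (?u y0) + ?e * norm ?h" by linarith
      moreover have "?e * norm ?h \<le> (c / 2) * norm ?h"
        using elim(1) by (intro mult_right_mono) auto
      ultimately have "c * norm ?h \<le> 2 * (?e * norm (?u y0))" by simp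
      then show ?case using c(1) by (simp add: field_simps)
    qed
  qed
  then have "((\<lambda>y. ?u y - ?u y0) \<longlongrightarrow> 0) ?F"
    by (rule Lim_null_comparison) (rule tendsto_mult_left_zero[OF lim])
  then show "(?u \<longlongrightarrow> ?u y0) ?F" by (rule LIM_zero_cancel)
qed

text \<open>
  The inverse function theorem with a \<open>C\<^sup>1\<close> inverse, in the special case of an identity differential
  at the base point, to which the use below is reduced.
\<close>

lemma C1_inverse_function:
  fixes f :: "'a::euclidean_space \<Rightarrow> 'a"
  assumes U: "open U" "x0 \<in> U" and f: "Ck_on 1 f U"
    and id: "\<And>h. frechet_derivative f (at x0) h = h"
  obtains U' V g where "x0 \<in> U'" "U' \<subseteq> U" "Ck_diffeo 1 V U' g f"
proof -
  define f' where "f' x = Blinfun (frechet_derivative f (at x))" for x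
  have f': "blinfun_apply (f' x) = frechet_derivative f (at x)"
    "(f has_derivative blinfun_apply (f' x)) (at x)" if "x \<in> U" for x
  proof -
    have "(f has_derivative frechet_derivative f (at x)) (at x)"
      using f that by (auto simp: Ck_on_1_iff frechet_derivative_works[symmetric])
    then show "blinfun_apply (f' x) = frechet_derivative f (at x)"
      "(f has_derivative blinfun_apply (f' x)) (at x)"
      by (simp_all add: f'_def bounded_linear_Blinfun_apply has_derivative_bounded_linear)
  qed
  have cont: "continuous_on U f'"
  proof (rule continuous_on_blinfun_componentwise)
    fix i :: 'a
    have "continuous_on U (\<lambda>x. frechet_derivative f (at x) i)" using f by (simp add: Ck_on_1_iff)
    then show "continuous_on U (\<lambda>x. blinfun_apply (f' x) i)"
      by (rule continuous_on_eq) (simp add: f')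
  qed
  obtain U' V g g' where *: "open U'" "U' \<subseteq> U" "x0 \<in> U'" "open V" "homeomorphism U' V f g"
    "\<And>y. y \<in> V \<Longrightarrow> (g has_derivative (g' y)) (at y)"
    "\<And>y. y \<in> V \<Longrightarrow> g' y = inv (blinfun_apply (f'(g y)))"
    "\<And>y. y \<in> V \<Longrightarrow> bij (blinfun_apply (f'(g y)))"
  proof (rule inverse_function_theorem[OF U(1) f'(2) cont U(2)])
    show "id_blinfun o\<^sub>L f' x0 = id_blinfun"
      by (rule blinfun_eqI) (simp add: f'(1)[OF U(2)] id)
  qed auto
  have gV: "g ` V = U'" "continuous_on V g" using *(5) by (auto simp: homeomorphism_def)
  have "Ck_on 1 g V" unfolding Ck_on_1_iff
  proof (intro conjI ballI allI)
    show "g differentiable at y" if "y \<in> V" for y using *(6)[OF that] differentiableI by blast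
    fix v
    have "continuous_on V (\<lambda>y. inv (blinfun_apply (f' (g y))) v)"
      by (rule continuous_on_inv_blinfun[OF _ *(8)], rule continuous_on_compose2[OF cont gV(2)])
         (use gV *(2) in auto)
    then show "continuous_on V (\<lambda>y. frechet_derivative g (at y) v)"
      by (rule continuous_on_eq) (metis *(6,7) frechet_derivative_at)
  qed
  moreover have "Ck_on 1 f U'" using f *(2) by (auto simp: Ck_on_1_iff intro: continuous_on_subset)
  ultimately have "Ck_diffeo 1 V U' g f"
    using *(1,4,5) homeomorphism_symD by (auto simp: Ck_diffeo_def)
  with * show ?thesis using that by blast
qed

text \<open>
  A submanifold \<open>P\<close> of a product on which the second projection is an immersion has a submanifold as
  its image. Let \<open>\<Psi>\<close> straighten \<open>P\<close> to the subspace \<open>L\<close>, let \<open>F\<close> be the differential of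
  \<open>snd \<circ> \<Psi>\<close>, injective on \<open>L\<close>, and let \<open>A\<close> be a linear left inverse of \<open>F\<close> on \<open>L\<close>. The map
  \<open>H y = snd (\<Psi> (q + A y)) + (y - F (A y))\<close> has the identity as differential at \<open>0\<close>, since the second
  summand supplies the directions transverse to \<open>T = F ` L\<close>; on \<open>T\<close> that summand vanishes, so
  that \<open>H\<close> carries \<open>T\<close> onto the image of \<open>P\<close>. The last conclusion says that the projection is
  open at \<open>x\<close> onto the image, which is what the notion of an image germ demands.
\<close>

lemma immersed_projection:
  fixes P :: "('e::euclidean_space \<times> 'f::euclidean_space) set"
  assumes P: "eucl_submanifold_at 1 j P x" and inj: "inj_on snd (eucl_tangent P x)"
    and Q: "open Q" "x \<in> Q"
  obtains W where "open W" "x \<in> W" "W \<subseteq> Q"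
    "eucl_submanifold_at 1 j (snd ` (P \<inter> W)) (snd x)"
    "\<And>p. p \<in> P \<inter> W \<Longrightarrow> eucl_tangent (snd ` (P \<inter> W)) (snd p) = snd ` eucl_tangent P p"
    "\<And>p. p \<in> P \<inter> W \<Longrightarrow> subspace (eucl_tangent P p)"
    "\<And>p. p \<in> P \<inter> W \<Longrightarrow> dim (eucl_tangent P p) = j"
    "\<And>p. p \<in> P \<inter> W \<Longrightarrow> dim (snd ` eucl_tangent P p) = j"
    "\<And>W'. open W' \<Longrightarrow> x \<in> W' \<Longrightarrow>
      \<exists>B. open B \<and> snd x \<in> B \<and> snd ` (P \<inter> W) \<inter> B \<subseteq> snd ` (P \<inter> W')"
proof -
  obtain U V \<Phi> \<Psi> L where x: "x \<in> P" "x \<in> U" and fl: "flattens 1 P U V \<Phi> \<Psi> L" and L: "dim L = j"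
    using P by (auto simp: eucl_submanifold_at_flattens)
  note f = flattensD[OF fl]
  note fl1 = fl[unfolded One_nat_def]
  define q where "q = \<Phi> x"
  have q: "q \<in> V" "q \<in> L" "\<Psi> q = x" using f x by (auto simp: q_def)
  define \<Psi>' where "\<Psi>' y = frechet_derivative \<Psi> (at y)" for y
  have \<Psi>': "(\<Psi> has_derivative \<Psi>' y) (at y)" if "y \<in> V" for y
    using f(6) that by (auto simp: \<Psi>'_def Ck_on_1_iff frechet_derivative_works[symmetric])
  have lin\<Psi>': "linear (\<Psi>' y)" if "y \<in> V" for y using \<Psi>'[OF that] has_derivative_linear by blast
  have cont\<Psi>': "continuous_on V (\<lambda>y. \<Psi>' y v)" for v using f(6) unfolding \<Psi>'_def Ck_on_1_iff by blast
  have cont\<Psi>: "continuous_on V \<Psi>" and cont\<Phi>: "continuous_on U \<Phi>"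
    using f(4) by (auto simp: homeomorphism_def)
  define F where "F h = snd (\<Psi>' q h)" for h
  have F: "linear F" unfolding F_def using linear_compose[OF lin\<Psi>'[OF q(1)] linear_snd] by (simp add: o_def)
  have "inj_on F L"
  proof -
    have "inj (\<Psi>' q)" using flattens_derivs(4)[OF fl1 x(2)]
      unfolding \<Psi>'_def q_def by (rule inj_on_inverseI)
    moreover have "inj_on snd (\<Psi>' q ` L)"
      using inj flattens_tangent(1)[OF fl1 x] by (simp add: \<Psi>'_def q_def)
    ultimately show ?thesis
      unfolding F_def inj_on_def by (metis image_eqI UNIV_I)
  qed
  then obtain A where A: "range A \<subseteq> L" "linear A" "\<And>l. l \<in> L \<Longrightarrow> A (F l) = l"
    using linear_exists_left_inverse_on[OF F f(3)] by metis
  define T where "T = F ` L"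
  have T: "subspace T" "dim T = j"
    unfolding T_def L[symmetric] using linear_subspace_image[OF F f(3)] dim_image_eq[OF F, of L]
      \<open>inj_on F L\<close> span_eq_iff[THEN iffD2, OF f(3)] by simp_all
  have FA: "F (A y) = y" if "y \<in> T" for y using that A(3) by (auto simp: T_def)
  have AT: "A ` T = L" unfolding T_def using A(3) by (force simp: image_image)
  define H where "H y = snd (\<Psi> (q + A y)) + (y - F (A y))" for y
  define H' where "H' y h = snd (\<Psi>' (q + A y) (A h)) + (h - F (A h))" for y h
  define G where "G = {y. q + A y \<in> V \<and> \<Psi> (q + A y) \<in> Q}"
  have contA: "continuous_on X A" for X using A(2) by (simp add: linear_continuous_on linear_conv_bounded_linear)
  have contF: "continuous_on X F" for X using F by (simp add: linear_continuous_on linear_conv_bounded_linear)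
  have "open (V \<inter> \<Psi> -` Q)" using continuous_open_preimage[OF cont\<Psi> f(2) Q(1)] .
  moreover have "G = (\<lambda>y. q + A y) -` (V \<inter> \<Psi> -` Q)" by (auto simp: G_def)
  ultimately have G: "open G"
    by (simp only:) (rule open_vimage, auto intro: continuous_on_add continuous_on_const contA)
  have G0: "0 \<in> G" using q Q linear_0[OF A(2)] by (simp add: G_def)
  have derH: "(H has_derivative H' y) (at y)" if "y \<in> G" for y
  proof -
    have dA: "(A has_derivative A) (at y)" and dF: "((\<lambda>y. F (A y)) has_derivative (\<lambda>y. F (A y))) (at y)"
      using linear_imp_has_derivative[OF A(2)] linear_imp_has_derivative[OF linear_compose[OF A(2) F]]
      by (simp_all add: o_def)
    have "((\<lambda>y. q + A y) has_derivative A) (at y)"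
      using has_derivative_add[OF has_derivative_const dA] by simp
    from has_derivative_compose[OF this \<Psi>'] that
    have "((\<lambda>y. \<Psi> (q + A y)) has_derivative (\<lambda>h. \<Psi>' (q + A y) (A h))) (at y)" by (simp add: G_def)
    then show ?thesis unfolding H_def H'_def
      by (intro has_derivative_add has_derivative_diff has_derivative_snd dF has_derivative_ident)
  qed
  then have frH: "frechet_derivative H (at y) = H' y" if "y \<in> G" for y
    using frechet_derivative_at that by metis
  have "Ck_on 1 H G" unfolding Ck_on_1_iff
  proof (intro conjI ballI allI)
    show "H differentiable at y" if "y \<in> G" for y using derH[OF that] differentiableI by blast
    fix v
    have "continuous_on G (\<lambda>y. \<Psi>' (q + A y) (A v))"
      by (rule continuous_on_compose2[OF cont\<Psi>']) (auto intro!: continuous_intros contA simp: G_def)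
    then have "continuous_on G (\<lambda>y. H' y v)" unfolding H'_def by (intro continuous_intros)
    then show "continuous_on G (\<lambda>y. frechet_derivative H (at y) v)"
      by (rule continuous_on_eq) (simp add: frH)
  qed
  moreover have "frechet_derivative H (at 0) h = h" for h
    by (simp add: frH[OF G0] H'_def linear_0[OF A(2)] F_def)
  ultimately obtain U' B0 g where U': "0 \<in> U'" "U' \<subseteq> G" and g: "Ck_diffeo 1 B0 U' g H"
    using C1_inverse_function[OF G G0] by metis
  have opn: "open U'" "open B0" and hom: "homeomorphism B0 U' g H" using g by (auto simp: Ck_diffeo_def)
  then have gH: "\<And>y. y \<in> U' \<Longrightarrow> H y \<in> B0" "\<And>y. y \<in> U' \<Longrightarrow> g (H y) = y" "\<And>b. b \<in> B0 \<Longrightarrow> g b \<in> U'"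
    "\<And>b. b \<in> B0 \<Longrightarrow> H (g b) = b" and contg: "continuous_on B0 g"
    by (auto simp: homeomorphism_def)
  have HT: "H y = snd (\<Psi> (q + A y))" if "y \<in> T" for y using FA[OF that] by (simp add: H_def)
  define W where "W = {p \<in> U. p \<in> Q \<and> F (\<Phi> p - q) \<in> U'}"
  have W: "open W"
  proof -
    have "continuous_on U (\<lambda>p. F (\<Phi> p - q))"
      by (rule continuous_on_compose2[OF contF[of UNIV]]) (auto intro!: continuous_intros cont\<Phi>)
    from continuous_open_preimage[OF this f(1) opn(1)]
    have "open (U \<inter> (\<lambda>p. F (\<Phi> p - q)) -` U' \<inter> Q)" using Q(1) by (rule open_Int)
    moreover have "U \<inter> (\<lambda>p. F (\<Phi> p - q)) -` U' \<inter> Q = W" by (auto simp: W_def)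
    ultimately show ?thesis by simp
  qed
  have xW: "x \<in> W" using x Q U'(1) linear_0[OF F] by (simp add: W_def q_def)
  have PW: "F (\<Phi> p - q) \<in> T \<inter> U'" "A (F (\<Phi> p - q)) = \<Phi> p - q" "H (F (\<Phi> p - q)) = snd p"
    if "p \<in> P \<inter> W" for p
  proof -
    have "\<Phi> p - q \<in> L" using that f q by (auto simp: W_def intro: subspace_diff)
    then show 1: "F (\<Phi> p - q) \<in> T \<inter> U'" "A (F (\<Phi> p - q)) = \<Phi> p - q"
      using that A(3) by (auto simp: T_def W_def)
    then show "H (F (\<Phi> p - q)) = snd p" using HT that f by (simp add: W_def)
  qed
  have TU: "\<Psi> (q + A y) \<in> P \<inter> W" "H y = snd (\<Psi> (q + A y))" if "y \<in> T \<inter> U'" for y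
  proof -
    have "q + A y \<in> L" using A(1) q f(3) by (auto intro: subspace_add)
    moreover have "q + A y \<in> V" "\<Psi> (q + A y) \<in> Q" using that U'(2) by (auto simp: G_def)
    ultimately show "\<Psi> (q + A y) \<in> P \<inter> W" using that f FA by (auto simp: W_def)
    show "H y = snd (\<Psi> (q + A y))" using HT that by auto
  qed
  define M where "M = snd ` (P \<inter> W)"
  have M: "M = H ` (T \<inter> U')"
  proof
    show "M \<subseteq> H ` (T \<inter> U')" using PW(1,3) unfolding M_def by (metis (no_types, lifting) image_iff image_subsetI)
    show "H ` (T \<inter> U') \<subseteq> M" using TU unfolding M_def by (metis (no_types, lifting) image_iff image_subsetI)
  qed
  have flM: "flattens 1 M B0 U' g H T"
  proof -
    have "M \<subseteq> B0" unfolding M using gH(1) by blast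
    then have "g ` (M \<inter> B0) = (\<lambda>y. g (H y)) ` (T \<inter> U')" unfolding M by (simp add: Int_absorb2 image_image)
    also have "\<dots> = U' \<inter> T" using gH(2) by force
    finally show ?thesis unfolding flattens_def using g T(1) by blast
  qed
  note flM1 = flM[unfolded One_nat_def]
  show ?thesis
  proof (rule that)
    show "open W" "x \<in> W" "W \<subseteq> Q" using W xW by (auto simp: W_def)
    have "snd x \<in> M" using x xW by (auto simp: M_def)
    moreover have "snd x \<in> B0" using gH(1)[OF U'(1)] PW(3)[of x] x xW linear_0[OF F]
      by (simp add: q_def)
    ultimately show "eucl_submanifold_at 1 j (snd ` (P \<inter> W)) (snd x)"
      unfolding eucl_submanifold_at_flattens M_def[symmetric] using flM T(2) by blast
    fix p assume p: "p \<in> P \<inter> W"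
    then have pU: "p \<in> P" "p \<in> U" by (auto simp: W_def)
    define y where "y = F (\<Phi> p - q)"
    have y: "y \<in> T" "y \<in> U'" "A y = \<Phi> p - q" "H y = snd p" using PW[OF p] by (auto simp: y_def)
    have Tp: "eucl_tangent P p = \<Psi>' (\<Phi> p) ` L" using flattens_tangent(1)[OF fl1 pU] by (simp add: \<Psi>'_def)
    have pM: "snd p \<in> M" "snd p \<in> B0" using p gH(1)[OF y(2)] y(4) by (auto simp: M_def)
    have "eucl_tangent M (snd p) = H' y ` T"
      using flattens_tangent(1)[OF flM1 pM] gH(2)[OF y(2)] y frH U'(2) by auto
    also have "\<dots> = (\<lambda>h. snd (\<Psi>' (\<Phi> p) (A h))) ` T"
      by (rule image_cong) (auto simp: H'_def y(3) FA)
    also have "\<dots> = snd ` eucl_tangent P p" unfolding Tp AT[symmetric] by (simp add: image_image)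
    finally show tan: "eucl_tangent (snd ` (P \<inter> W)) (snd p) = snd ` eucl_tangent P p" by (simp add: M_def)
    show "subspace (eucl_tangent P p)" "dim (eucl_tangent P p) = j"
      using flattens_tangent(2,3)[OF fl1 pU] L by auto
    show "dim (snd ` eucl_tangent P p) = j"
      using flattens_tangent(3)[OF flM1 pM] tan T(2) by (simp add: M_def)
  next
    fix W' :: "('e \<times> 'f) set" assume W': "open W'" "x \<in> W'"
    define B where "B = B0 \<inter> (\<lambda>b. \<Psi> (q + A (g b))) -` W'"
    have "continuous_on B0 (\<lambda>b. q + A (g b))"
      by (intro continuous_on_add continuous_on_const continuous_on_compose2[OF contA[of UNIV] contg]) simp
    moreover have "(\<lambda>b. q + A (g b)) ` B0 \<subseteq> V" using gH(3) U'(2) by (force simp: G_def)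
    ultimately have "continuous_on B0 (\<lambda>b. \<Psi> (q + A (g b)))"
      by (rule continuous_on_compose2[OF cont\<Psi>])
    then have "open B" unfolding B_def using continuous_open_preimage opn(2) W'(1) by blast
    moreover have "snd x \<in> B"
      using gH(1,2)[OF U'(1)] PW(3)[of x] x xW linear_0[OF F] linear_0[OF A(2)] q W'(2)
      by (simp add: q_def B_def)
    moreover have "snd ` (P \<inter> W) \<inter> B \<subseteq> snd ` (P \<inter> W')"
    proof
      fix m assume m: "m \<in> snd ` (P \<inter> W) \<inter> B"
      then obtain y where y: "y \<in> T \<inter> U'" "m = H y" using M M_def by auto
      with m have "\<Psi> (q + A y) \<in> W'" using gH(2) by (auto simp: B_def)
      with TU[OF y(1)] y(2) show "m \<in> snd ` (P \<inter> W')" by blast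
    qed
    ultimately show "\<exists>B. open B \<and> snd x \<in> B \<and> snd ` (P \<inter> W) \<inter> B \<subseteq> snd ` (P \<inter> W')" by blast
  qed
qed

section \<open>Affine charts of the projective plane\<close>

lemma index_cases: obtains "k = i" | "k = i + 1" | "k = i + (2::3)"
proof -
  have three: "(3::3) = 0" by simp
  have "k - i = 1 \<or> k - i = 2 \<or> k - i = 0"
    using exhaust_3[of "k - i"] three by metis
  then show ?thesis using that by (auto simp: diff_eq_eq add.commute)
qed

lemma UNIV_index: "UNIV = {i, i + 1, i + (2::3)}"
  using index_cases[of _ i] by blast

lemma sum_index: "(\<Sum>k\<in>UNIV. f k) = f i + f (i + 1) + f (i + (2::3))"
  by (subst UNIV_index[of i]) (simp add: add.assoc)

text \<open>
  Homogeneous coordinates of the point with affine coordinates \<open>w\<close> in chart \<open>i\<close>, and their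
  differential in \<open>w\<close>.
\<close>

definition homog :: "3 \<Rightarrow> complex \<times> complex \<Rightarrow> complex^3" where
  "homog i w = (\<chi> k. if k = i then 1 else if k = i + 1 then fst w else snd w)"

definition dhomog :: "3 \<Rightarrow> complex \<times> complex \<Rightarrow> complex^3" where
  "dhomog i w = (\<chi> k. if k = i then 0 else if k = i + 1 then fst w else snd w)"

definition affine_point :: "3 \<Rightarrow> complex \<times> complex \<Rightarrow> cp2" where
  "affine_point i w = abs_cp2 (homog i w)"

definition pairing :: "complex^3 \<Rightarrow> complex^3 \<Rightarrow> complex" where
  "pairing v a = (\<Sum>k\<in>UNIV. a $ k * v $ k)"

lemma homog_nth [simp]: "homog i w $ i = 1" "homog i w $ (i + 1) = fst w" "homog i w $ (i + 2) = snd w"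
  and dhomog_nth [simp]: "dhomog i w $ i = 0" "dhomog i w $ (i + 1) = fst w" "dhomog i w $ (i + 2) = snd w"
  by (simp_all add: homog_def dhomog_def)

lemma homog_neq_0 [simp]: "homog i w \<noteq> 0"
  by (metis homog_nth(1) zero_index zero_neq_one)

lemma homog_add: "homog i (w + w') = homog i w + dhomog i w'"
  by (simp add: homog_def dhomog_def vec_eq_iff)

lemma linear_dhomog: "linear (dhomog i)"
  by (rule linearI) (simp_all add: dhomog_def vec_eq_iff)

lemma dhomog_smult: "dhomog i (c * fst w, c * snd w) = c *s dhomog i w"
  by (simp add: dhomog_def vec_eq_iff)

lemma pairing_commute: "pairing v a = pairing a v" by (simp add: pairing_def mult.commute)

lemma pairing_left [simp]: "pairing (v + v') a = pairing v a + pairing v' a" "pairing (c *s v) a = c * pairing v a"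
    "pairing (r *\<^sub>R v) a = r *\<^sub>R pairing v a" "pairing 0 a = 0"
  by (simp_all add: pairing_def sum.distrib sum_distrib_left scaleR_sum_right algebra_simps)

lemma pairing_right [simp]: "pairing v (a + a') = pairing v a + pairing v a'" "pairing v (c *s a) = c * pairing v a"
    "pairing v (r *\<^sub>R a) = r *\<^sub>R pairing v a" "pairing v 0 = 0"
  by (simp_all add: pairing_commute[of v])

lemma pairing_homog: "pairing (homog i w) a = a $ i + (a $ (i + 1) * fst w + a $ (i + 2) * snd w)"
  by (simp add: pairing_def sum_index[of _ i])

lemma pairing_dhomog: "pairing (dhomog i w) a = a $ (i + 1) * fst w + a $ (i + 2) * snd w"
  by (simp add: pairing_def sum_index[of _ i])

lemma bounded_bilinear_pairing: "bounded_bilinear pairing"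
  by (rule bilinear_conv_bounded_bilinear[THEN iffD1])
    (auto simp: bilinear_def intro!: linearI)

lemma homog_has_derivative: "(homog i has_derivative dhomog i) F"
proof -
  define c where "c = homog i 0"
  have "homog i = (\<lambda>w. c + dhomog i w)" unfolding c_def by (rule ext) (subst homog_add[symmetric], simp)
  moreover have "((\<lambda>w. c + dhomog i w) has_derivative dhomog i) F"
    using has_derivative_add[OF has_derivative_const linear_imp_has_derivative[OF linear_dhomog]] by simp
  ultimately show ?thesis by simp
qed

lemma refl_cp2: "v \<noteq> 0 \<Longrightarrow> v \<noteq> 0 \<and> v \<noteq> 0 \<and> (\<exists>c. v = c *s (v::complex^3))"
  by (auto intro: exI[of _ 1])

lemma abs_cp2_eq_iff:
  assumes "v \<noteq> 0" "w \<noteq> 0"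
  shows "abs_cp2 v = abs_cp2 w \<longleftrightarrow> (\<exists>c. w = c *s v)"
  using Quotient_rel[OF Quotient_cp2, of v w] refl_cp2[OF assms(1)] refl_cp2[OF assms(2)] by blast

lemma cp2_cases: obtains v where "v \<noteq> 0" "z = abs_cp2 v"
proof -
  have "\<exists>v. v \<noteq> 0 \<and> z = abs_cp2 v" by (rule cp2.abs_induct) auto
  with that show ?thesis by blast
qed

lemma affine_dom_abs [simp]: "v \<noteq> 0 \<Longrightarrow> affine_dom i (abs_cp2 v) \<longleftrightarrow> v $ i \<noteq> 0"
  by (rule affine_dom.abs_eq) (rule refl_cp2)

lemma affine_coord_abs [simp]:
  "v \<noteq> 0 \<Longrightarrow> affine_coord i (abs_cp2 v) = (v $ (i + 1) / v $ i, v $ (i + 2) / v $ i)"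
  by (rule affine_coord.abs_eq) (rule refl_cp2)

lemma incident_abs: "v \<noteq> 0 \<Longrightarrow> a \<noteq> 0 \<Longrightarrow> incident (abs_cp2 v) (abs_cp2 a) \<longleftrightarrow> pairing v a = 0"
  unfolding pairing_def by (rule incident.abs_eq) (rule refl_cp2, assumption)+

lemma affine_point_simps [simp]: "affine_dom i (affine_point i w)" "affine_coord i (affine_point i w) = w"
  by (simp_all add: affine_point_def)

lemma affine_dom_affine_point: "affine_dom j (affine_point i w) \<longleftrightarrow> homog i w $ j \<noteq> 0"
  by (simp add: affine_point_def)

lemma homog_affine_coord:
  assumes "v \<noteq> 0" "v $ i \<noteq> 0"
  shows "homog i (affine_coord i (abs_cp2 v)) = inverse (v $ i) *s v"
proof -
  have "homog i (affine_coord i (abs_cp2 v)) $ k = (inverse (v $ i) *s v) $ k" for k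
    by (rule index_cases[of k i]) (use assms in \<open>simp_all add: divide_inverse_commute\<close>)
  then show ?thesis by (simp add: vec_eq_iff)
qed

lemma affine_point_affine_coord [simp]: "affine_dom i z \<Longrightarrow> affine_point i (affine_coord i z) = z"
proof (rule cp2_cases[of z])
  fix v assume v: "v \<noteq> 0" "z = abs_cp2 v" and "affine_dom i z"
  then have "v $ i \<noteq> 0" by simp
  then have "homog i (affine_coord i z) = inverse (v $ i) *s v" using homog_affine_coord[OF v(1)] v(2) by blast
  then show ?thesis
    using abs_cp2_eq_iff[OF v(1) homog_neq_0, of i "affine_coord i z"] v(2) unfolding affine_point_def by metis
qed

lemma continuous_on_abs_cp2: "continuous_on {v. v \<noteq> 0} abs_cp2"
proof -
  have "open (abs_cp2 -` B \<inter> {v. v \<noteq> 0})" if "open B" for B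
    using that unfolding open_cp2_def by (simp add: vimage_def Int_def conj_commute)
  moreover have "open {v::complex^3. v \<noteq> 0}" by (simp add: open_Collect_neq)
  ultimately show ?thesis by (simp add: continuous_on_open_vimage)
qed

lemma continuous_on_homog: "continuous_on S (homog i)"
  by (rule has_derivative_continuous_on[where f' = "\<lambda>_. dhomog i"]) (rule homog_has_derivative)

lemma continuous_on_affine_point: "continuous_on S (affine_point i)"
  unfolding affine_point_def by (rule continuous_on_compose2[OF continuous_on_abs_cp2 continuous_on_homog]) auto

lemma open_affine_dom: "open {z. affine_dom i z}"
proof -
  have nz: "v $ i \<noteq> 0 \<Longrightarrow> v \<noteq> 0" for v :: "complex^3" by auto
  have "{v. v \<noteq> 0 \<and> abs_cp2 v \<in> {z. affine_dom i z}} = {v. v $ i \<noteq> 0}"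
    using nz by (auto simp del: zero_index)
  moreover have "open {v::complex^3. v $ i \<noteq> 0}" by (intro open_Collect_neq continuous_intros)
  ultimately show ?thesis unfolding open_cp2_def by metis
qed

lemma continuous_on_affine_coord: "continuous_on {z. affine_dom i z} (affine_coord i)"
proof -
  have "open (affine_coord i -` B \<inter> {z. affine_dom i z})" if B: "open B" for B
  proof -
    let ?f = "\<lambda>v::complex^3. (v $ (i + 1) / v $ i, v $ (i + 2) / v $ i)" and ?D = "{v::complex^3. v $ i \<noteq> 0}"
    have nz: "v $ i \<noteq> 0 \<Longrightarrow> v \<noteq> 0" for v :: "complex^3" by auto
    have "{v. v \<noteq> 0 \<and> abs_cp2 v \<in> affine_coord i -` B \<inter> {z. affine_dom i z}} = ?D \<inter> ?f -` B"
      using nz by (auto simp del: zero_index)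
    moreover have "open (?D \<inter> ?f -` B)"
      by (rule continuous_open_preimage[OF _ _ B]) (auto intro!: continuous_intros open_Collect_neq)
    ultimately show ?thesis unfolding open_cp2_def by simp
  qed
  then show ?thesis by (simp add: continuous_on_open_vimage open_affine_dom)
qed

abbreviation chart :: "3 \<Rightarrow> (cp2, complex \<times> complex) chart" where
  "chart i \<equiv> ({z. affine_dom i z}, affine_coord i)"

abbreviation chart2 :: "3 \<Rightarrow> 3 \<Rightarrow> (cp2 \<times> cp2, (complex \<times> complex) \<times> (complex \<times> complex)) chart" where
  "chart2 i j \<equiv> ({z. affine_dom i z} \<times> {z. affine_dom j z}, map_prod (affine_coord i) (affine_coord j))"

lemma cp2_atlas_eq: "cp2_atlas = range chart"
  by (auto simp: cp2_atlas_def)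

lemma prod_atlas_eq: "prod_atlas cp2_atlas cp2_atlas = {chart2 i j | i j. True}"
  by (auto simp: cp2_atlas_def prod_atlas_def; blast)

text \<open>
  Both \<^const>\<open>lift\<close> and \<^const>\<open>generic_at\<close> ask for the existence of some chart. The following three
  lemmas allow any chart to be used instead.
\<close>

lemma transition_derivative:
  assumes "affine_dom i z" "affine_dom i' z"
  shows "\<exists>D D'. ((\<lambda>w. affine_coord i' (affine_point i w)) has_derivative D) (at (affine_coord i z)) \<and>
    ((\<lambda>w. affine_coord i (affine_point i' w)) has_derivative D') (at (affine_coord i' z)) \<and>
    (\<forall>v. D' (D v) = v) \<and> (\<forall>v. D (D' v) = v)"
proof -
  let ?g = "\<lambda>i i' w. affine_coord i' (affine_point i w)"
  have ex: "\<exists>D. (?g i i' has_derivative D) (at (affine_coord i z))" if "affine_dom i z" "affine_dom i' z" for i i'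
  proof -
    have nz: "homog i (affine_coord i z) $ i' \<noteq> 0" using that affine_dom_affine_point[of i' i "affine_coord i z"] by simp
    have nth: "((\<lambda>w. homog i w $ k) has_derivative (\<lambda>w. dhomog i w $ k)) (at w)" for k w
      using bounded_linear.has_derivative[OF bounded_linear_vec_nth homog_has_derivative] .
    have "?g i i' = (\<lambda>w. (homog i w $ (i' + 1) / homog i w $ i', homog i w $ (i' + 2) / homog i w $ i'))"
      by (simp add: affine_point_def fun_eq_iff)
    then show ?thesis
      by (simp only:) (rule exI, rule has_derivative_Pair[OF has_derivative_divide[OF nth nth nz] has_derivative_divide[OF nth nth nz]])
  qed
  obtain D D' where D: "(?g i i' has_derivative D) (at (affine_coord i z))"
    "(?g i' i has_derivative D') (at (affine_coord i' z))"
    using ex assms by metis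
  have op: "open {w. affine_dom i' (affine_point i w)}" for i i'
    unfolding affine_dom_affine_point
    by (intro open_Collect_neq continuous_intros continuous_on_homog)
  have "D' (D v) = v" for v
    by (rule has_derivative_inverse_pair[OF D(1) _ op[of i' i]]) (use D assms in auto)
  moreover have "D (D' v) = v" for v
    by (rule has_derivative_inverse_pair[OF D(2) _ op[of i i']]) (use D assms in auto)
  ultimately show ?thesis using D by blast
qed

lemma tangent_in_transition:
  assumes "affine_dom i z" "affine_dom i' z"
  obtains D where "linear D" "bij D"
    "\<And>S. tangent_in (chart i') S z = D ` tangent_in (chart i) S z"
proof -
  let ?g = "\<lambda>i i' w. affine_coord i' (affine_point i w)"
  obtain D D' where D: "(?g i i' has_derivative D) (at (affine_coord i z))"
    "(?g i' i has_derivative D') (at (affine_coord i' z))" "\<And>v. D' (D v) = v" "\<And>v. D (D' v) = v"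
    using transition_derivative[OF assms] by blast
  have op: "open {w. affine_dom i' (affine_point i w)}" for i i'
    unfolding affine_dom_affine_point by (intro open_Collect_neq continuous_intros continuous_on_homog)
  show ?thesis
  proof (rule that)
    show "linear D" using D(1) has_derivative_linear by blast
    show "bij D" using D(3,4) by (metis bijI')
    fix S
    have "eucl_tangent (affine_coord i' ` (S \<inter> {z. affine_dom i' z})) (?g i i' (affine_coord i z)) =
        D ` eucl_tangent (affine_coord i ` (S \<inter> {z. affine_dom i z})) (affine_coord i z)"
      by (rule eucl_tangent_local_diffeo[OF D(1) _ op[of i' i] _ _ _ op[of i i']])
        (use D assms in \<open>auto simp: image_iff\<close>)
    then show "tangent_in (chart i') S z = D ` tangent_in (chart i) S z"
      using assms by (simp add: tangent_in_def)
  qed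
qed

lemma tangent_in_transition2:
  assumes "affine_dom i z" "affine_dom i' z" "affine_dom j d" "affine_dom j' d"
  obtains D E where "linear D" "bij D" "linear E" "bij E" "j = j' \<Longrightarrow> E = id"
    "\<And>S. tangent_in (chart2 i' j') S (z, d) = map_prod D E ` tangent_in (chart2 i j) S (z, d)"
proof -
  let ?g = "\<lambda>i i' w. affine_coord i' (affine_point i w)"
  obtain D D' where D: "(?g i i' has_derivative D) (at (affine_coord i z))"
    "(?g i' i has_derivative D') (at (affine_coord i' z))" "\<And>v. D' (D v) = v" "\<And>v. D (D' v) = v"
    using transition_derivative[OF assms(1,2)] by blast
  obtain E E' where E: "(?g j j' has_derivative E) (at (affine_coord j d))"
    "(?g j' j has_derivative E') (at (affine_coord j' d))" "\<And>v. E' (E v) = v" "\<And>v. E (E' v) = v"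
    using transition_derivative[OF assms(3,4)] by blast
  have op: "open {p. affine_dom i' (affine_point i (fst p)) \<and> affine_dom j' (affine_point j (snd p))}" for i i' j j'
    unfolding affine_dom_affine_point
    by (intro open_Collect_conj open_Collect_neq continuous_intros continuous_on_compose2[OF continuous_on_homog[of UNIV]]) auto
  have der: "(map_prod f g has_derivative map_prod f' g') (at (x, y))"
    if "(f has_derivative f') (at x)" "(g has_derivative g') (at y)" for f g :: "complex \<times> complex \<Rightarrow> complex \<times> complex" and f' g' x y
  proof -
    have "((\<lambda>p. f (fst p)) has_derivative (\<lambda>p. f' (fst p))) (at (x, y))"
      "((\<lambda>p. g (snd p)) has_derivative (\<lambda>p. g' (snd p))) (at (x, y))"
      using has_derivative_compose[OF has_derivative_fst[OF has_derivative_ident], of f f' "(x,y)" UNIV]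
        has_derivative_compose[OF has_derivative_snd[OF has_derivative_ident], of g g' "(x,y)" UNIV] that by auto
    from has_derivative_Pair[OF this] show ?thesis by (simp add: map_prod_def case_prod_unfold)
  qed
  show ?thesis
  proof (rule that)
    show "linear D" "linear E" using D(1) E(1) has_derivative_linear by blast+
    show "bij D" "bij E" using D(3,4) E(3,4) by (metis bijI')+
    show "E = id" if "j = j'"
    proof -
      have "(?g j j' has_derivative (\<lambda>x. x)) (at (affine_coord j d))" using that by (simp add: has_derivative_ident)
      from has_derivative_unique[OF E(1) this] show ?thesis by (simp add: id_def)
    qed
    fix S
    let ?O = "\<lambda>i i' j j'. {p. affine_dom i' (affine_point i (fst p)) \<and> affine_dom j' (affine_point j (snd p))}"
    have sub: "map_prod (?g i i') (?g j j') ` (snd (chart2 i j) ` (S \<inter> fst (chart2 i j)) \<inter> ?O i i' j j')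
        \<subseteq> snd (chart2 i' j') ` (S \<inter> fst (chart2 i' j'))" for i i' j j'
    proof clarsimp
      fix z d assume "(z, d) \<in> S" "affine_dom i' z" "affine_dom j' d"
      then show "(affine_coord i' z, affine_coord j' d) \<in> map_prod (affine_coord i') (affine_coord j') `
          (S \<inter> {z. affine_dom i' z} \<times> {z. affine_dom j' z})"
        by (intro image_eqI[of _ _ "(z, d)"]) auto
    qed
    have inv: "map_prod (?g i' i) (?g j' j) (map_prod (?g i i') (?g j j') p) = p" if "p \<in> ?O i i' j j'" for i i' j j' p
      using that by (cases p) auto
    have mem: "(affine_coord i z, affine_coord j d) \<in> ?O i i' j j'"
      if "affine_dom i z" "affine_dom i' z" "affine_dom j d" "affine_dom j' d" for i i' j j'
      using that by auto
    have eq: "map_prod (?g i i') (?g j j') (affine_coord i z, affine_coord j d) = (affine_coord i' z, affine_coord j' d)"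
      using assms by simp
    have "eucl_tangent (snd (chart2 i' j') ` (S \<inter> fst (chart2 i' j')))
        (map_prod (?g i i') (?g j j') (affine_coord i z, affine_coord j d)) =
        map_prod D E ` eucl_tangent (snd (chart2 i j) ` (S \<inter> fst (chart2 i j))) (affine_coord i z, affine_coord j d)"
      by (rule eucl_tangent_local_diffeo[OF der[OF D(1) E(1)] _ op[of i' i j' j] mem[OF assms] inv sub
            op[of i i' j j'] _ inv sub]) (use der[OF D(2) E(2)] mem[of i' i j' j] assms eq in simp_all)
    then show "tangent_in (chart2 i' j') S (z, d) = map_prod D E ` tangent_in (chart2 i j) S (z, d)"
      using assms by (simp add: tangent_in_def)
  qed
qed

section \<open>The lift in terms of conormal covectors\<close>

lemma tangent_in_UNIV:
  assumes "affine_dom i z"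
  shows "tangent_in (chart i) UNIV z = UNIV"
proof -
  have "affine_coord i ` {z. affine_dom i z} = UNIV" by (metis UNIV_eq_I image_eqI mem_Collect_eq affine_point_simps)
  then show ?thesis using eucl_tangent_subspace[of UNIV UNIV] by (simp add: tangent_in_def)
qed

lemma tangent_in_line:
  assumes z: "affine_dom i z" and a: "a \<noteq> 0" "pairing (homog i (affine_coord i z)) a = 0"
  shows "tangent_in (chart i) (line (abs_cp2 a)) z = {w. pairing (dhomog i w) a = 0}"
proof -
  let ?L = "{w. pairing (dhomog i w) a = 0}" and ?w = "affine_coord i z" and ?S = "{w. pairing (homog i w) a = 0}"
  have inc: "incident (affine_point i w) (abs_cp2 a) \<longleftrightarrow> w \<in> ?S" for w
    using a(1) by (simp add: affine_point_def incident_abs)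
  have "affine_coord i ` (line (abs_cp2 a) \<inter> {z. affine_dom i z}) = ?S"
  proof (intro set_eqI iffI)
    fix w assume "w \<in> ?S"
    then have "affine_point i w \<in> line (abs_cp2 a) \<inter> {z. affine_dom i z}" using inc by (simp add: line_def)
    then show "w \<in> affine_coord i ` (line (abs_cp2 a) \<inter> {z. affine_dom i z})"
      by (metis image_eqI affine_point_simps(2))
  next
    fix w assume "w \<in> affine_coord i ` (line (abs_cp2 a) \<inter> {z. affine_dom i z})"
    then obtain z' where "w = affine_coord i z'" "incident z' (abs_cp2 a)" "affine_dom i z'"
      by (auto simp: line_def)
    then show "w \<in> ?S" using inc[of w] by simp
  qed
  moreover have "eucl_tangent ?S (?w + 0) = (\<lambda>v. v) ` eucl_tangent ?L 0"
  proof (rule eucl_tangent_local_diffeo[where h = "\<lambda>v. - ?w + v" and h' = "\<lambda>v. v" and W = UNIV and W' = UNIV])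
    show "((+) ?w has_derivative (\<lambda>v. v)) (at 0)" "((\<lambda>v. - ?w + v) has_derivative (\<lambda>v. v)) (at (?w + 0))"
      by (rule has_derivative_add[OF has_derivative_const has_derivative_ident, THEN has_derivative_eq_rhs], simp)+
    have shift: "?w + v \<in> ?S \<longleftrightarrow> v \<in> ?L" for v by (simp add: homog_add a(2))
    then show "(+) ?w ` (?L \<inter> UNIV) \<subseteq> ?S" by blast
    have "- ?w + u \<in> ?L" if "u \<in> ?S" for u using shift[of "- ?w + u"] that by simp
    then show "(\<lambda>v. - ?w + v) ` (?S \<inter> UNIV) \<subseteq> ?L" by blast
  qed simp_all
  moreover have "subspace ?L"
    by (rule subspaceI) (auto simp: linear_0[OF linear_dhomog] linear_add[OF linear_dhomog] linear_cmul[OF linear_dhomog])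
  ultimately show ?thesis
    using eucl_tangent_subspace[of ?L UNIV 0] by (simp add: tangent_in_def linear_0[OF linear_dhomog])
qed

lemma linear_image_sums:
  assumes "linear D"
  shows "{u + v | u v. u \<in> D ` A \<and> v \<in> D ` B} = D ` {u + v | u v. u \<in> A \<and> v \<in> B}"
proof
  show "{u + v | u v. u \<in> D ` A \<and> v \<in> D ` B} \<subseteq> D ` {u + v | u v. u \<in> A \<and> v \<in> B}"
  proof clarify
    fix u v assume "u \<in> A" "v \<in> B"
    then show "D u + D v \<in> D ` {u + v | u v. u \<in> A \<and> v \<in> B}"
      by (intro image_eqI[of _ D "u + v"]) (auto simp: linear_add[OF assms])
  qed
  show "D ` {u + v | u v. u \<in> A \<and> v \<in> B} \<subseteq> {u + v | u v. u \<in> D ` A \<and> v \<in> D ` B}"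
    using linear_add[OF assms] by blast
qed

lemma lift_iff_chart:
  assumes z: "affine_dom i z"
  shows "(z, d) \<in> lift N \<longleftrightarrow> incident z d \<and> z \<in> N \<and>
    {u + v | u v. u \<in> tangent_in (chart i) (line d) z \<and> v \<in> tangent_in (chart i) N z} \<noteq> UNIV"
proof -
  let ?S = "\<lambda>i. {u + v | u v. u \<in> tangent_in (chart i) (line d) z \<and> v \<in> tangent_in (chart i) N z}"
  have "?S i' = UNIV \<longleftrightarrow> ?S i = UNIV" if i': "affine_dom i' z" for i'
  proof -
    obtain D where D: "linear D" "bij D"
      "\<And>S. tangent_in (chart i') S z = D ` tangent_in (chart i) S z"
      using tangent_in_transition[OF z i'] by blast
    have "?S i' = D ` ?S i"
      unfolding D(3) by (rule linear_image_sums[OF D(1)])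
    moreover have "D ` X = UNIV \<longleftrightarrow> X = UNIV" for X
      using inj_image_eq_iff[of D X UNIV] D(2) by (simp add: bij_def)
    ultimately show ?thesis by (simp only:)
  qed
  then have eq: "(?S i' \<noteq> tangent_in (chart i') UNIV z) = (?S i \<noteq> UNIV)" if "affine_dom i' z" for i'
    unfolding tangent_in_UNIV[OF that] using that by (simp only:)
  have atlas: "(\<exists>c\<in>cp2_atlas. z \<in> fst c \<and> X c) \<longleftrightarrow> B"
    if "\<And>i'. affine_dom i' z \<Longrightarrow> X (chart i') = B" for X and B
    using that z by (auto simp: cp2_atlas_eq)
  have "(\<exists>c\<in>cp2_atlas. z \<in> fst c \<and> {u + v | u v. u \<in> tangent_in c (line d) z \<and> v \<in> tangent_in c N z}
      \<noteq> tangent_in c UNIV z) \<longleftrightarrow> ?S i \<noteq> UNIV"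
    by (rule atlas) (rule eq)
  moreover have "z \<in> line d \<longleftrightarrow> incident z d" by (simp add: line_def)
  ultimately show ?thesis unfolding lift_def flag_variety_def mem_Collect_eq case_prod_conv by (simp only:)
qed

text \<open>
  The functional of a covector \<open>a\<close> on directions in the affine chart is not zero, because the
  remaining coordinate of \<open>a\<close> is determined by incidence with a point of the chart.
\<close>

lemma exists_dhomog_eq_1:
  assumes "a \<noteq> 0" "pairing (homog i w) a = 0"
  obtains e where "pairing (dhomog i e) a = 1"
proof -
  have "a $ (i + 1) \<noteq> 0 \<or> a $ (i + 2) \<noteq> 0"
  proof (rule ccontr)
    assume "\<not> ?thesis"
    then have "a $ k = 0" for k
      using assms(2) by (cases k rule: index_cases[where i = i]) (auto simp: pairing_homog)
    then show False using assms(1) by (simp add: vec_eq_iff)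
  qed
  then show ?thesis
    using that[of "(1 / a $ (i + 1), 0)"] that[of "(0, 1 / a $ (i + 2))"] by (auto simp: pairing_dhomog)
qed

lemma dhomog_eq_smult_add:
  "dhomog i w = dhomog i (w - (c * fst e, c * snd e)) + c *s dhomog i e"
  using linear_diff[OF linear_dhomog, of i w "(c * fst e, c * snd e)"] by (simp add: dhomog_smult)

text \<open>
  The sum of the tangent spaces of \<open>d\<close> and \<open>N\<close> is proper iff a nonzero real functional vanishes on it.
  A real functional that vanishes on the complex line \<open>T\<^sub>z d\<close> is the real part of a complex multiple of
  the functional defining \<open>T\<^sub>z d\<close>, and the multiple is absorbed into the homogeneous vector of \<open>d\<close>.
\<close>

lemma lift_iff_conormal:
  assumes z: "affine_dom i z" and T: "subspace (tangent_in (chart i) N z)"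
  shows "(z, d) \<in> lift N \<longleftrightarrow> z \<in> N \<and>
    (\<exists>a. a \<noteq> 0 \<and> d = abs_cp2 a \<and> pairing (homog i (affine_coord i z)) a = 0 \<and>
      (\<forall>w\<in>tangent_in (chart i) N z. Re (pairing (dhomog i w) a) = 0))"
proof -
  let ?T = "tangent_in (chart i) N z" and ?h = "homog i (affine_coord i z)"
  have inc: "incident z (abs_cp2 a) \<longleftrightarrow> pairing ?h a = 0" if "a \<noteq> 0" for a
    using incident_abs[OF homog_neq_0[of i "affine_coord i z"] that] z by (simp add: affine_point_def[symmetric])
  show ?thesis
  proof (intro iffI conjI)
    assume l: "(z, d) \<in> lift N"
    then show "z \<in> N" using lift_iff_chart[OF z] by blast
    obtain a0 where a0: "a0 \<noteq> 0" "d = abs_cp2 a0" using cp2_cases .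
    then have h0: "pairing ?h a0 = 0" using l lift_iff_chart[OF z] inc by blast
    let ?L = "{w. pairing (dhomog i w) a0 = 0}"
    let ?S = "{u + v | u v. u \<in> ?L \<and> v \<in> ?T}"
    have L: "subspace ?L"
      by (rule subspaceI) (auto simp: linear_0[OF linear_dhomog] linear_add[OF linear_dhomog] linear_cmul[OF linear_dhomog])
    have "?S \<noteq> UNIV" using l lift_iff_chart[OF z] tangent_in_line[OF z a0(1) h0] a0(2) by simp
    moreover have S: "span ?S = ?S" using subspace_sums[OF L T] by (rule span_eq_iff[THEN iffD2])
    ultimately have "span ?S \<noteq> UNIV" by metis
    from span_not_UNIV_orthogonal[OF this]
    obtain g where g: "g \<noteq> 0" and gspan: "\<forall>x \<in> span ?S. g \<bullet> x = 0" by auto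
    have g2: "g \<bullet> x = 0" if "x \<in> ?S" for x using gspan span_base[OF that] by (rule bspec)
    have gL: "g \<bullet> u = 0" if "u \<in> ?L" for u
    proof -
      have "u + 0 \<in> ?S" using that subspace_0[OF T] by blast
      then show ?thesis using g2 by (metis (no_types, lifting) add_0_right add_0_left)
    qed
    have gT: "g \<bullet> u = 0" if "u \<in> ?T" for u
    proof -
      have "0 + u \<in> ?S" using that subspace_0[OF L] by blast
      then show ?thesis using g2 by (metis (no_types, lifting) add_0_right add_0_left)
    qed
    obtain e where e: "pairing (dhomog i e) a0 = 1" using exists_dhomog_eq_1[OF a0(1) h0] .
    \<comment> \<open>As \<open>g\<close> vanishes on the kernel of \<open>a0\<close>, it is determined by its values on the complex multiples of \<open>e\<close>.\<close>
    define r where "r c = g \<bullet> (c * fst e, c * snd e)" for c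
    define l where "l = Complex (r 1) (- r \<i>)"
    have r: "r c = Re (l * c)" for c
    proof -
      have "r c = Re c * r 1 + Im c * r \<i>"
        by (simp add: r_def l_def inner_prod_def inner_complex_def algebra_simps)
      then show ?thesis by (simp add: l_def algebra_simps)
    qed
    have gl: "g \<bullet> w = Re (pairing (dhomog i w) (l *s a0))" for w
    proof -
      let ?c = "pairing (dhomog i w) a0"
      have "pairing (dhomog i (w - (?c * fst e, ?c * snd e))) a0 = 0"
        using arg_cong[OF dhomog_eq_smult_add[of i w ?c e], of "\<lambda>x. pairing x a0"] e by simp
      then have "g \<bullet> (w - (?c * fst e, ?c * snd e)) = 0" using gL by blast
      then have "g \<bullet> w = r ?c" by (simp add: r_def inner_diff_right)
      then show ?thesis by (simp add: r)
    qed
    then have "l \<noteq> 0" using g gl[of g] by (metis pairing_right(4) inner_eq_zero_iff vector_smult_lzero zero_complex.simps(1))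
    then have "l *s a0 \<noteq> 0" "d = abs_cp2 (l *s a0)"
      using a0 abs_cp2_eq_iff[of a0 "l *s a0"] by (auto simp: vec_eq_iff)
    moreover have "pairing ?h (l *s a0) = 0" using h0 by simp
    ultimately show "\<exists>a. a \<noteq> 0 \<and> d = abs_cp2 a \<and> pairing ?h a = 0 \<and> (\<forall>w\<in>?T. Re (pairing (dhomog i w) a) = 0)"
      using gl gT by metis
  next
    assume "z \<in> N \<and> (\<exists>a. a \<noteq> 0 \<and> d = abs_cp2 a \<and> pairing ?h a = 0 \<and> (\<forall>w\<in>?T. Re (pairing (dhomog i w) a) = 0))"
    then obtain a where a: "z \<in> N" "a \<noteq> 0" "d = abs_cp2 a" "pairing ?h a = 0"
      "\<And>w. w\<in>?T \<Longrightarrow> Re (pairing (dhomog i w) a) = 0" by blast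
    obtain e where e: "pairing (dhomog i e) a = 1" using exists_dhomog_eq_1[OF a(2,4)] .
    have "Re (pairing (dhomog i (u + v)) a) = 0" if "pairing (dhomog i u) a = 0" "v \<in> ?T" for u v
      using that a(5) by (simp add: linear_add[OF linear_dhomog])
    then have "e \<notin> {u + v | u v. u \<in> {w. pairing (dhomog i w) a = 0} \<and> v \<in> ?T}"
      using e by force
    then show "(z, d) \<in> lift N"
      unfolding lift_iff_chart[OF z] a(3) tangent_in_line[OF z a(2,4)] using a(1) inc[OF a(2)] a(4) by blast
  qed
qed

lemma proportional_of_kernel:
  assumes v: "v \<noteq> 0" "pairing (homog j u) v = 0" "pairing (homog j u) v' = 0"
    and ker: "\<And>w. pairing (dhomog j w) v = 0 \<Longrightarrow> pairing (dhomog j w) v' = 0"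
  obtains c where "v' = c *s v"
proof -
  obtain e where e: "pairing (dhomog j e) v = 1" using exists_dhomog_eq_1[OF v(1,2)] .
  define c where "c = pairing (dhomog j e) v'"
  have pr: "pairing (dhomog j w) v' = c * pairing (dhomog j w) v" for w
  proof -
    let ?f = "pairing (dhomog j w) v"
    have "pairing (dhomog j (w - (?f * fst e, ?f * snd e))) v = 0"
      using arg_cong[OF dhomog_eq_smult_add[of j w ?f e], of "\<lambda>x. pairing x v"] e by simp
    then show ?thesis
      using arg_cong[OF dhomog_eq_smult_add[of j w ?f e], of "\<lambda>x. pairing x v'"] ker by (simp add: c_def)
  qed
  have 1: "v' $ (j + 1) = c * v $ (j + 1)" and 2: "v' $ (j + 2) = c * v $ (j + 2)"
    using pr[of "(1, 0)"] pr[of "(0, 1)"] by (simp_all add: pairing_dhomog)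
  have "v $ j = - (v $ (j + 1) * fst u + v $ (j + 2) * snd u)"
    and "v' $ j = - (v' $ (j + 1) * fst u + v' $ (j + 2) * snd u)"
    using v(2,3) unfolding pairing_homog eq_neg_iff_add_eq_0 .
  then have "v' $ j = c * v $ j" unfolding 1 2 by (simp only:) (simp add: algebra_simps)
  with 1 2 have "v' $ k = (c *s v) $ k" for k by (cases k rule: index_cases[where i = j]) auto
  then have "v' = c *s v" by (simp add: vec_eq_iff)
  then show ?thesis by (rule that)
qed

section \<open>Conormal covectors and the rank of the lift\<close>

text \<open>On the orthogonal complement of its kernel, \<open>f\<close> is injective.\<close>

lemma rank_nullity_le:
  fixes f :: "'a::euclidean_space \<Rightarrow> 'b::euclidean_space"
  assumes f: "linear f" and R: "range f \<subseteq> R"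
  shows "DIM('a) \<le> dim R + dim {x. f x = 0}"
proof -
  let ?K = "{x. f x = 0}" and ?C = "{y \<in> UNIV. \<forall>x\<in>{x. f x = 0}. orthogonal x y}"
  have K: "subspace ?K" by (rule linear_subspace_kernel[OF f])
  have C: "subspace ?C" using subspace_orthogonal_to_vectors[of ?K] by simp
  have "dim ?C + dim ?K = DIM('a)"
    using dim_subspace_orthogonal_to_vectors[OF K subspace_UNIV subset_UNIV] by (simp add: dim_UNIV)
  moreover have "inj_on f (span ?C)"
    unfolding span_eq_iff[THEN iffD2, OF C] linear_injective_on_subspace_0[OF f C]
    by (auto simp: orthogonal_self)
  then have "dim (f ` ?C) = dim ?C" by (rule dim_image_eq[OF f])
  moreover have "dim (f ` ?C) \<le> dim R" using R by (intro dim_subset) auto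
  ultimately show ?thesis by simp
qed

lemma linear_orthogonal_projection:
  assumes L: "subspace (L :: 'a::euclidean_space set)"
  obtains p where "linear p" "\<And>x. p x \<in> L" "\<And>x l. l \<in> L \<Longrightarrow> (x - p x) \<bullet> l = 0"
proof -
  obtain B where B: "B \<subseteq> L" "pairwise orthogonal B" "\<And>x. x \<in> B \<Longrightarrow> norm x = 1"
    "independent B" "card B = dim L" "span B = L"
    using orthonormal_basis_subspace[OF L] by metis
  have fin: "finite B" using B(4) independent_imp_finite by blast
  define p where "p x = (\<Sum>b\<in>B. (x \<bullet> b) *\<^sub>R b)" for x
  show ?thesis
  proof (rule that)
    show "linear p" unfolding p_def
      by (rule linearI) (simp_all add: inner_add_left scaleR_add_left sum.distrib scaleR_sum_right)
    show "p x \<in> L" for x unfolding p_def using B(1) L by (intro subspace_sum subspace_mul) auto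
    have ortho: "orthogonal (x - p x) b" if b: "b \<in> B" for x b
    proof -
      have "p x \<bullet> b = (\<Sum>b'\<in>B. if b' = b then x \<bullet> b else 0)"
        unfolding p_def inner_sum_left
      proof (rule sum.cong)
        fix b' assume "b' \<in> B"
        then show "(x \<bullet> b') *\<^sub>R b' \<bullet> b = (if b' = b then x \<bullet> b else 0)"
          using b B(2) B(3)[OF b] by (auto simp: pairwise_def orthogonal_def dot_square_norm)
      qed simp
      then show ?thesis using fin b by (simp add: orthogonal_def inner_diff_left)
    qed
    show "(x - p x) \<bullet> l = 0" if "l \<in> L" for x l
      using orthogonal_to_span[of l B "x - p x"] that ortho B(6) by (auto simp: orthogonal_def)
  qed
qed

text \<open>
  The transpose of the derivative of \<open>\<Phi>\<close> at \<open>y\<close>, applied to \<open>\<eta>\<close>. It is written in coordinates because this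
  form shows that it is differentiable in \<open>y\<close> when \<open>\<Phi>\<close> is of class \<open>C\<^sup>2\<close>.
\<close>

definition pullback :: "('a::euclidean_space \<Rightarrow> 'a) \<Rightarrow> 'a \<Rightarrow> 'a \<Rightarrow> 'a" where
  "pullback \<Phi> y \<eta> = (\<Sum>b\<in>Basis. (\<eta> \<bullet> frechet_derivative \<Phi> (at y) b) *\<^sub>R b)"

lemma pullback_inner:
  assumes "linear (frechet_derivative \<Phi> (at y))"
  shows "pullback \<Phi> y \<eta> \<bullet> w = \<eta> \<bullet> frechet_derivative \<Phi> (at y) w"
proof -
  have "frechet_derivative \<Phi> (at y) w = (\<Sum>b\<in>Basis. (w \<bullet> b) *\<^sub>R frechet_derivative \<Phi> (at y) b)"
    by (subst euclidean_representation[of w, symmetric]) (simp add: linear_sum[OF assms] linear_cmul[OF assms])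
  then show ?thesis by (simp add: pullback_def inner_sum_left inner_sum_right mult.commute inner_commute)
qed

lemma linear_pullback: "linear (pullback \<Phi> y)"
  unfolding pullback_def
  by (rule linearI) (simp_all add: inner_add_left scaleR_add_left sum.distrib scaleR_sum_right)

text \<open>
  The line through the point \<open>w\<close> of chart \<open>i\<close> whose functional on directions has the real part
  \<open>g \<bullet> _\<close>: this is why the conjugates of the components of \<open>g\<close> appear. The coordinate \<open>i\<close> is
  forced by incidence.
\<close>

definition covector :: "3 \<Rightarrow> complex \<times> complex \<Rightarrow> complex \<times> complex \<Rightarrow> complex^3" where
  "covector i w g = (\<chi> k. if k = i then - (cnj (fst g) * fst w + cnj (snd g) * snd w)
    else if k = i + 1 then cnj (fst g) else cnj (snd g))"

lemma covector_nth [simp]: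
  "covector i w g $ i = - (cnj (fst g) * fst w + cnj (snd g) * snd w)"
  "covector i w g $ (i + 1) = cnj (fst g)" "covector i w g $ (i + 2) = cnj (snd g)"
  by (simp_all add: covector_def)

lemma Re_pairing_covector: "Re (pairing (dhomog i v) (covector i w g)) = g \<bullet> v"
  by (simp add: pairing_dhomog inner_prod_def inner_complex_def)

lemma pairing_homog_covector: "pairing (homog i w) (covector i w g) = 0"
  by (simp add: pairing_homog)

lemma covector_unique:
  assumes "pairing (homog i w) a = 0"
  shows "a = covector i w (cnj (a $ (i + 1)), cnj (a $ (i + 2)))"
proof -
  have "a $ i = - (a $ (i + 1) * fst w + a $ (i + 2) * snd w)"
    using assms unfolding pairing_homog eq_neg_iff_add_eq_0 .
  then have "a $ k = covector i w (cnj (a $ (i + 1)), cnj (a $ (i + 2))) $ k" for k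
    by (cases k rule: index_cases[where i = i]) auto
  then show ?thesis unfolding vec_eq_iff by blast
qed

lemma covector_eq_0: "covector i w g = 0 \<longleftrightarrow> g = 0"
proof
  assume "covector i w g = 0"
  then have "cnj (fst g) = 0" "cnj (snd g) = 0" by (metis covector_nth(2) zero_index, metis covector_nth(3) zero_index)
  then show "g = 0" by (simp add: prod_eq_iff)
qed (simp add: covector_def vec_eq_iff)

lemma linear_covector: "linear (covector i w)"
  by (rule linearI) (auto simp: covector_def vec_eq_iff algebra_simps)

lemma differentiable_covector:
  assumes w: "w differentiable (at x)" and g: "g differentiable (at x)"
  shows "(\<lambda>x. covector i (w x) (g x)) differentiable (at x)"
proof -
  define C where "C g = (\<chi> k. if k = i then 0 else if k = i + 1 then cnj (fst g) else cnj (snd g))"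
    for g :: "complex \<times> complex"
  define B where "B w g = axis i (- (cnj (fst g) * fst w + cnj (snd g) * snd w))"
    for w g :: "complex \<times> complex"
  have eq: "covector i w g = C g + B w g" for w g
    by (simp add: covector_def B_def C_def axis_def vec_eq_iff)
  have "linear C" by (rule linearI) (auto simp: C_def vec_eq_iff)
  then have C: "bounded_linear C" by (simp add: linear_conv_bounded_linear)
  have "bilinear B" unfolding bilinear_def
    by (auto intro!: linearI simp: B_def axis_def vec_eq_iff algebra_simps)
  then have B: "bounded_bilinear B" by (simp add: bilinear_conv_bounded_bilinear)
  obtain w' g' where w': "(w has_derivative w') (at x)" and g': "(g has_derivative g') (at x)"
    using w g by (auto simp: differentiable_def)
  show ?thesis unfolding eq
    using has_derivative_add[OF bounded_linear.has_derivative[OF C g'] bounded_bilinear.FDERIV[OF B w' g']]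
    by (rule differentiableI)
qed

text \<open>
  The kernel of the differential of an affine coordinate map on homogeneous vectors is the complex
  line of the vector itself.
\<close>

lemma kernel_quotient_derivative:
  fixes a :: "complex^3"
  assumes a: "a $ j \<noteq> 0"
  obtains D where "((\<lambda>v. (v $ (j + 1) / v $ j, v $ (j + 2) / v $ j)) has_derivative D) (at a)"
    "\<And>h. D h = 0 \<Longrightarrow> h = (h $ j / a $ j) *s a"
proof -
  have nth: "((\<lambda>v. v $ k) has_derivative (\<lambda>h. h $ k)) (at a)" for k
    using bounded_linear.has_derivative[OF bounded_linear_vec_nth has_derivative_ident] .
  show ?thesis
  proof (rule that[OF has_derivative_Pair[OF has_derivative_divide'[OF nth nth a] has_derivative_divide'[OF nth nth a]]])
    fix h assume "((h $ (j + 1) * a $ j - a $ (j + 1) * h $ j) / (a $ j * a $ j),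
      (h $ (j + 2) * a $ j - a $ (j + 2) * h $ j) / (a $ j * a $ j)) = 0"
    then have "h $ (j + 1) = (h $ j / a $ j) * a $ (j + 1)" "h $ (j + 2) = (h $ j / a $ j) * a $ (j + 2)"
      using a by (auto simp: zero_prod_def field_simps)
    moreover have "h $ j = (h $ j / a $ j) * a $ j" using a by simp
    ultimately have "h $ k = ((h $ j / a $ j) *s a) $ k" for k
      by (cases k rule: index_cases[where i = j]) auto
    then show "h = (h $ j / a $ j) *s a" unfolding vec_eq_iff by blast
  qed
qed

abbreviation (input) chart_image :: "3 \<Rightarrow> cp2 set \<Rightarrow> (complex \<times> complex) set" where
  "chart_image i N \<equiv> affine_coord i ` (N \<inter> {z. affine_dom i z})"

lemma chart_image_iff: "y \<in> chart_image i N \<longleftrightarrow> affine_point i y \<in> N"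
  by (metis (mono_tags, lifting) IntI IntE imageE image_eqI mem_Collect_eq affine_point_affine_coord affine_point_simps)

text \<open>
  In the following, \<open>\<Phi>\<close> and \<open>\<Psi>\<close> straighten the coordinate image of \<open>N\<close> to the subspace \<open>L\<close>. The conormal
  covectors of \<open>N\<close> at \<open>y\<close> are then the pullbacks of the vectors orthogonal to \<open>L\<close>.
\<close>

context
  fixes N i U V \<Phi> \<Psi> L
  assumes fl: "flattens 2 (chart_image i N) U V \<Phi> \<Psi> L"
begin

lemma flattens_Suc: "flattens (Suc 1) (chart_image i N) U V \<Phi> \<Psi> L"
  using fl by (simp add: numeral_2_eq_2)

lemma tangent_in_flattens:
  assumes "z \<in> N" "affine_dom i z" "affine_coord i z \<in> U"
  shows "tangent_in (chart i) N z = frechet_derivative \<Psi> (at (\<Phi> (affine_coord i z))) ` L"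
    "subspace (tangent_in (chart i) N z)"
  using flattens_tangent[OF flattens_Suc, of "affine_coord i z"] assms by (auto simp: tangent_in_def)

lemma lift_pullback:
  assumes "affine_point i y \<in> N" "y \<in> U" and \<eta>: "\<eta> \<noteq> 0" "\<And>l. l \<in> L \<Longrightarrow> \<eta> \<bullet> l = 0"
  defines "a \<equiv> covector i y (pullback \<Phi> y \<eta>)"
  shows "a \<noteq> 0" "(affine_point i y, abs_cp2 a) \<in> lift N"
proof -
  note d = flattens_derivs[OF flattens_Suc assms(2)]
  note T = tangent_in_flattens[of "affine_point i y", simplified, OF assms(1,2)]
  have lin: "linear (frechet_derivative \<Phi> (at y))" using d(1) has_derivative_linear by blast
  have "pullback \<Phi> y \<eta> \<bullet> frechet_derivative \<Psi> (at (\<Phi> y)) \<eta> \<noteq> 0"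
    using \<eta>(1) by (simp add: pullback_inner[OF lin] d(4))
  then show a: "a \<noteq> 0" unfolding a_def covector_eq_0 by auto
  have "Re (pairing (dhomog i w) a) = 0" if "w \<in> tangent_in (chart i) N (affine_point i y)" for w
    using that \<eta>(2) unfolding T(1) a_def Re_pairing_covector pullback_inner[OF lin] by (auto simp: d(4))
  moreover have "pairing (homog i y) a = 0" by (simp add: a_def pairing_homog_covector)
  ultimately show "(affine_point i y, abs_cp2 a) \<in> lift N"
    unfolding lift_iff_conormal[OF affine_point_simps(1) T(2)] affine_point_simps(2) using assms(1) a by blast
qed

lemma lift_pullback_ex:
  assumes l: "(affine_point i y, d) \<in> lift N" and y: "y \<in> U"
  obtains \<eta> where "\<eta> \<noteq> 0" "\<And>l. l \<in> L \<Longrightarrow> \<eta> \<bullet> l = 0" "d = abs_cp2 (covector i y (pullback \<Phi> y \<eta>))"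
proof -
  have N: "affine_point i y \<in> N" using l by (auto simp: lift_def)
  note d = flattens_derivs[OF flattens_Suc y]
  note T = tangent_in_flattens[of "affine_point i y", simplified, OF N y]
  have lin: "linear (frechet_derivative \<Phi> (at y))" "linear (frechet_derivative \<Psi> (at (\<Phi> y)))"
    using d(1,2) has_derivative_linear by blast+
  obtain a where a: "a \<noteq> 0" "d = abs_cp2 a" "pairing (homog i y) a = 0"
    "\<forall>w\<in>tangent_in (chart i) N (affine_point i y). Re (pairing (dhomog i w) a) = 0"
    using l unfolding lift_iff_conormal[OF affine_point_simps(1) T(2)] affine_point_simps(2) by blast
  define g where "g = (cnj (a $ (i + 1)), cnj (a $ (i + 2)))"
  have g: "a = covector i y g" unfolding g_def by (rule covector_unique[OF a(3)])
  define \<eta> where "\<eta> = adjoint (frechet_derivative \<Psi> (at (\<Phi> y))) g"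
  have \<eta>: "\<eta> \<bullet> v = g \<bullet> frechet_derivative \<Psi> (at (\<Phi> y)) v" for v
    unfolding \<eta>_def by (rule adjoint_clauses(2)[OF lin(2)])
  have pb: "pullback \<Phi> y \<eta> = g"
    by (rule vector_eq_rdot[THEN iffD1]) (simp add: pullback_inner[OF lin(1)] \<eta> d(3))
  show ?thesis
  proof (rule that)
    show "\<eta> \<noteq> 0" using a(1) pb g linear_0[OF linear_pullback, of \<Phi> y] covector_eq_0 by metis
    show "\<eta> \<bullet> l = 0" if "l \<in> L" for l
      unfolding \<eta> using a(4) that unfolding T(1) g Re_pairing_covector by auto
    show "d = abs_cp2 (covector i y (pullback \<Phi> y \<eta>))" using a(2) pb g by simp
  qed
qed

lemma differentiable_pullback:
  assumes Y: "Y differentiable (at x)" "Y x \<in> U" and e: "e differentiable (at x)"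
  shows "(\<lambda>x. pullback \<Phi> (Y x) (e x)) differentiable (at x)"
  unfolding pullback_def
proof (intro differentiable_sum ballI)
  fix b :: "complex \<times> complex"
  have "(\<lambda>y. frechet_derivative \<Phi> (at y) b) differentiable (at (Y x))"
    using flattensD(5)[OF fl] Y(2) unfolding numeral_2_eq_2 Ck_on.simps by blast
  then have "(\<lambda>x. frechet_derivative \<Phi> (at (Y x)) b) differentiable (at x)"
    using differentiable_chain_at[OF Y(1)] by (simp add: o_def)
  then show "(\<lambda>x. (e x \<bullet> frechet_derivative \<Phi> (at (Y x)) b) *\<^sub>R b) differentiable (at x)"
    using e by (intro differentiable_scaleR differentiable_inner differentiable_const)
qed simp

text \<open>
  With \<open>p\<close> the orthogonal projection to \<open>L\<close>, the map \<open>Q\<close> sends a small \<open>x\<close> to the point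
  \<open>\<Psi> (\<Phi> y + p x)\<close> of \<open>N\<close> with the line conormal there, given by the covector \<open>\<eta> + (x - p x)\<close>. It takes values
  in the lift, so the range of its differential is tangent to the lift. The kernel of the
  differential embeds, by \<open>G\<close>, into the complex multiples of the covector \<open>a\<close> of \<open>d\<close>: it has dimension at
  most \<open>2\<close>, and when it has dimension \<open>2\<close> the covector \<open>\<i> *s a\<close> is conormal as well.
\<close>

lemma lift_rank:
  assumes l: "(affine_point i y, d) \<in> lift N" and y: "y \<in> U" and d: "affine_dom j d"
    and R: "tangent_in (chart2 i j) (lift N) (affine_point i y, d) \<subseteq> R"
  shows "2 \<le> dim R"
    "dim R = 2 \<Longrightarrow> w \<in> tangent_in (chart i) N (affine_point i y) \<Longrightarrow> pairing (dhomog i w) (homog j (affine_coord j d)) = 0"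
proof -
  have yN: "affine_point i y \<in> N" using l by (auto simp: lift_def)
  note f = flattensD[OF fl] and fd = flattens_derivs[OF flattens_Suc y]
  define \<Psi>' where "\<Psi>' = frechet_derivative \<Psi> (at (\<Phi> y))"
  have lin: "linear (frechet_derivative \<Phi> (at y))" "linear \<Psi>'"
    using fd(1,2) has_derivative_linear unfolding \<Psi>'_def by blast+
  obtain \<eta> where \<eta>: "\<eta> \<noteq> 0" "\<And>l. l \<in> L \<Longrightarrow> \<eta> \<bullet> l = 0"
    "d = abs_cp2 (covector i y (pullback \<Phi> y \<eta>))"
    using lift_pullback_ex[OF l y] by blast
  define a where "a = covector i y (pullback \<Phi> y \<eta>)"
  have a0: "a \<noteq> 0" using lift_pullback(1)[OF yN y \<eta>(1,2)] by (simp add: a_def)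
  have aj: "a $ j \<noteq> 0" using d affine_dom_abs[OF a0] \<eta>(3) by (simp add: a_def)
  obtain p where p: "linear p" "\<And>x. p x \<in> L" "\<And>x l. l \<in> L \<Longrightarrow> (x - p x) \<bullet> l = 0"
    using linear_orthogonal_projection[OF f(3)] by blast
  define Y where "Y x = \<Psi> (\<Phi> y + p x)" for x
  define e where "e x = \<eta> + (x - p x)" for x
  define v where "v x = covector i (Y x) (pullback \<Phi> (Y x) (e x))" for x
  define kap where "kap v = (v $ (j + 1) / v $ j, v $ (j + 2) / v $ j)" for v :: "complex^3"
  have at0: "Y 0 = y" "e 0 = \<eta>" "v 0 = a"
    using linear_0[OF p(1)] f(10) y by (simp_all add: Y_def e_def v_def a_def)
  have dp: "(p has_derivative p) (at 0)" using linear_imp_has_derivative[OF p(1)] .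
  have "((\<lambda>x. \<Phi> y + p x) has_derivative p) (at 0)"
    using has_derivative_add[OF has_derivative_const dp] by simp
  from has_derivative_compose[OF this, of \<Psi> \<Psi>'] fd(2)
  have dY: "(Y has_derivative (\<lambda>x. \<Psi>' (p x))) (at 0)"
    unfolding Y_def \<Psi>'_def using linear_0[OF p(1)] by simp
  have de: "(e has_derivative (\<lambda>x. x - p x)) (at 0)"
    unfolding e_def using has_derivative_add[OF has_derivative_const has_derivative_diff[OF has_derivative_ident dp]] by simp
  have "v differentiable (at 0)"
    unfolding v_def using differentiableI[OF dY] differentiableI[OF de] y at0(1)
    by (intro differentiable_covector differentiable_pullback) auto
  then obtain v' where dv: "(v has_derivative v') (at 0)" by (auto simp: differentiable_def)
  obtain D where D: "(kap has_derivative D) (at a)" "\<And>h. D h = 0 \<Longrightarrow> h = (h $ j / a $ j) *s a"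
    using kernel_quotient_derivative[OF aj] unfolding kap_def by blast
  define Q where "Q x = (Y x, kap (v x))" for x
  define Q' where "Q' x = (\<Psi>' (p x), D (v' x))" for x
  have dQ: "(Q has_derivative Q') (at 0)"
    unfolding Q_def Q'_def using has_derivative_Pair[OF dY has_derivative_compose[OF dv, of kap D]] D(1) at0(3) by simp
  let ?P = "map_prod (affine_coord i) (affine_coord j) ` (lift N \<inter> {z. affine_dom i z} \<times> {z. affine_dom j z})"
  have "\<forall>\<^sub>F x in nhds 0. \<Phi> y + p x \<in> V \<and> e x \<noteq> 0 \<and> v x $ j \<noteq> 0"
  proof (intro eventually_conj)
    have lim: "(f \<longlongrightarrow> f 0) (nhds 0)" if "(f has_derivative f') (at 0)"
      for f :: "complex \<times> complex \<Rightarrow> 'b::real_normed_vector" and f'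
      using has_derivative_continuous[OF that] by (simp add: isCont_def tendsto_at_iff_tendsto_nhds)
    have "((\<lambda>x. \<Phi> y + p x) \<longlongrightarrow> \<Phi> y + p 0) (nhds 0)" by (intro tendsto_intros lim[OF dp])
    then show "\<forall>\<^sub>F x in nhds 0. \<Phi> y + p x \<in> V"
      by (rule topological_tendstoD[OF _ f(2)]) (use f(8) y linear_0[OF p(1)] in simp)
    show "\<forall>\<^sub>F x in nhds 0. e x \<noteq> 0"
      using lim[OF de] \<eta>(1) by (intro tendsto_imp_eventually_ne) (auto simp: at0)
    have "((\<lambda>x. v x $ j) \<longlongrightarrow> v 0 $ j) (nhds 0)" by (intro tendsto_vec_nth lim[OF dv])
    then show "\<forall>\<^sub>F x in nhds 0. v x $ j \<noteq> 0"
      by (rule tendsto_imp_eventually_ne) (simp add: at0 aj)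
  qed
  then obtain W where W: "open W" "0 \<in> W"
    "\<And>x. x \<in> W \<Longrightarrow> \<Phi> y + p x \<in> V \<and> e x \<noteq> 0 \<and> v x $ j \<noteq> 0"
    by (auto simp: eventually_nhds)
  have "Q x \<in> ?P" if x: "x \<in> W" for x
  proof -
    have "\<Phi> y \<in> L" unfolding f(12)[OF y] chart_image_iff by (rule yN)
    then have "\<Phi> y + p x \<in> L" using f(3) p(2) by (intro subspace_add)
    then have YU: "Y x \<in> U" "affine_point i (Y x) \<in> N"
      unfolding chart_image_iff[symmetric] Y_def using W(3)[OF x] f(9,13) by blast+
    have "e x \<bullet> l = 0" if "l \<in> L" for l using \<eta>(2)[OF that] p(3)[OF that] by (simp add: e_def inner_add_left)
    from lift_pullback[OF YU(2,1) _ this] W(3)[OF x]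
    have nz: "v x \<noteq> 0" and lft: "(affine_point i (Y x), abs_cp2 (v x)) \<in> lift N" by (simp_all add: v_def)
    have "Q x = map_prod (affine_coord i) (affine_coord j) (affine_point i (Y x), abs_cp2 (v x))"
      using nz by (simp add: Q_def kap_def)
    then show ?thesis using lft W(3)[OF x] nz by (intro image_eqI) auto
  qed
  then have "Q' ` eucl_tangent UNIV 0 \<subseteq> eucl_tangent ?P (Q 0)"
    by (intro eucl_tangent_image_subset[OF dQ W(1,2)]) auto
  moreover have "eucl_tangent (UNIV :: (complex \<times> complex) set) 0 = UNIV"
    using eucl_tangent_subspace[of "UNIV :: (complex \<times> complex) set" UNIV 0] by simp
  moreover have "Q 0 = map_prod (affine_coord i) (affine_coord j) (affine_point i y, d)"
    using a0 \<eta>(3) by (simp add: Q_def at0 kap_def a_def)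
  ultimately have "range Q' \<subseteq> R" using R by (simp add: tangent_in_def)
  let ?K = "{x. Q' x = 0}"
  have lQ': "linear Q'" using dQ has_derivative_linear by blast
  have rank: "4 \<le> dim R + dim ?K"
    using rank_nullity_le[OF lQ' \<open>range Q' \<subseteq> R\<close>] by simp
  define G where "G x = covector i y (pullback \<Phi> y x)" for x
  have G: "linear G" unfolding G_def using linear_compose[OF linear_pullback linear_covector] by (simp add: o_def)
  have "G x = 0 \<Longrightarrow> x = 0" for x
    using pullback_inner[OF lin(1), of x "\<Psi>' x"] fd(4) by (simp add: G_def covector_eq_0 \<Psi>'_def)
  then have injG: "inj G" using linear_injective_0[OF G] by blast
  have K: "p x = 0 \<and> (\<exists>c. G x = c *s a)" if "x \<in> ?K" for x
  proof -
    from that have 1: "\<Psi>' (p x) = 0" "D (v' x) = 0" by (simp_all add: Q'_def zero_prod_def)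
    then have px: "p x = 0" using fd(4)[of "p x"] linear_0[OF lin(1)] by (simp add: \<Psi>'_def)
    \<comment> \<open>With \<open>p x = 0\<close> the base point does not move, so \<open>v\<close> is affine along the line through \<open>x\<close>.\<close>
    have "v (t *\<^sub>R x) = a + t *\<^sub>R G x" for t :: real
    proof -
      have "p (t *\<^sub>R x) = 0" using px linear_cmul[OF p(1)] by simp
      then show ?thesis using f(10) y
        by (simp add: v_def Y_def e_def a_def G_def linear_add[OF linear_pullback] linear_add[OF linear_covector]
          linear_cmul[OF linear_pullback] linear_cmul[OF linear_covector])
    qed
    then have "((\<lambda>t. v (t *\<^sub>R x)) has_derivative (\<lambda>t. t *\<^sub>R G x)) (at 0)"
      by (auto intro!: derivative_eq_intros)
    moreover have "((\<lambda>t::real. v (t *\<^sub>R x)) has_derivative (\<lambda>t. v' (t *\<^sub>R x))) (at 0)"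
      by (rule has_derivative_compose[of _ "\<lambda>t. t *\<^sub>R x"]) (use dv in \<open>auto intro!: derivative_eq_intros\<close>)
    ultimately have "(\<lambda>t. t *\<^sub>R G x) = (\<lambda>t. v' (t *\<^sub>R x))" by (rule has_derivative_unique)
    from fun_cong[OF this, of 1] have "v' x = G x" by simp
    with D(2)[OF 1(2)] px show ?thesis by metis
  qed
  let ?C = "span {a, \<i> *s a}"
  have "G ` ?K \<subseteq> ?C"
  proof clarify
    fix x assume "Q' x = 0"
    then obtain c where "G x = c *s a" using K by blast
    also have "\<dots> = Re c *\<^sub>R a + Im c *\<^sub>R (\<i> *s a)"
      by (simp add: vec_eq_iff) (metis complex_eq mult.assoc mult.commute scaleR_conv_of_real distrib_right)
    also have "\<dots> \<in> ?C" by (intro span_add span_scale span_base) auto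
    finally show "G x \<in> ?C" .
  qed
  have dimK: "dim (G ` ?K) = dim ?K"
    by (rule dim_image_eq[OF G]) (use injG inj_on_subset in blast)
  have dimC: "dim ?C \<le> 2"
    using dim_le_card[of "{a, \<i> *s a}" "{a, \<i> *s a}"]
    by (auto simp: span_superset card_insert_if split: if_splits)
  have "dim ?K \<le> 2" using dim_subset[OF \<open>G ` ?K \<subseteq> ?C\<close>] dimK dimC by simp
  with rank show "2 \<le> dim R" by simp
  assume "dim R = 2" and w: "w \<in> tangent_in (chart i) N (affine_point i y)"
  then have "dim ?C \<le> dim (G ` ?K)" using rank dimK dimC by simp
  then have "G ` ?K = ?C"
    using \<open>G ` ?K \<subseteq> ?C\<close> linear_subspace_image[OF G linear_subspace_kernel[OF lQ']]
    by (intro subspace_dim_equal) auto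
  then have "\<i> *s a \<in> G ` ?K" by (auto intro: span_base)
  then obtain x where x: "x \<in> ?K" "G x = \<i> *s a" by auto
  note T = tangent_in_flattens[of "affine_point i y", simplified, OF yN y]
  obtain l where l: "l \<in> L" "w = \<Psi>' l" using w unfolding T(1) \<Psi>'_def by blast
  have "Re (pairing (dhomog i w) (G x')) = x' \<bullet> l" for x'
    using fd(4) by (simp add: G_def Re_pairing_covector pullback_inner[OF lin(1)] l(2) \<Psi>'_def)
  from this[of x] this[of \<eta>] have "Re (pairing (dhomog i w) (\<i> *s a)) = 0" "Re (pairing (dhomog i w) a) = 0"
    using p(3)[OF l(1), of x] K[OF x(1)] \<eta>(2)[OF l(1)] x(2) by (simp_all add: G_def a_def)
  then have "pairing (dhomog i w) a = 0" by (simp add: complex_eq_iff)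
  moreover have "homog j (affine_coord j d) = inverse (a $ j) *s a"
    using homog_affine_coord[OF a0 aj] \<eta>(3) by (simp add: a_def)
  ultimately show "pairing (dhomog i w) (homog j (affine_coord j d)) = 0" by simp
qed

text \<open>
  The pullback of one fixed \<open>\<eta>\<close> orthogonal to \<open>L\<close> extends the given conormal covector continuously
  to the nearby points of \<open>N\<close>.
\<close>

lemma lift_section:
  assumes l: "(affine_point i y, d) \<in> lift N" and y: "y \<in> U" and Q: "open Q" "(affine_point i y, d) \<in> Q"
  obtains B where "open B" "y \<in> B" "B \<subseteq> U"
    "\<And>y'. y' \<in> B \<Longrightarrow> affine_point i y' \<in> N \<Longrightarrow> \<exists>d'. (affine_point i y', d') \<in> lift N \<inter> Q"
proof -
  have yN: "affine_point i y \<in> N" using l by (auto simp: lift_def)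
  obtain \<eta> where \<eta>: "\<eta> \<noteq> 0" "\<And>l. l \<in> L \<Longrightarrow> \<eta> \<bullet> l = 0"
    "d = abs_cp2 (covector i y (pullback \<Phi> y \<eta>))"
    using lift_pullback_ex[OF l y] by blast
  define a where "a y' = covector i y' (pullback \<Phi> y' \<eta>)" for y'
  have "a y \<noteq> 0" using lift_pullback(1)[OF yN y \<eta>(1,2)] by (simp add: a_def)
  have "a differentiable (at y)"
    unfolding a_def using y by (intro differentiable_covector differentiable_pullback) (auto intro: differentiable_const)
  then have "isCont a y" by (rule differentiable_imp_continuous_within)
  then have a: "(a \<longlongrightarrow> a y) (nhds y)" by (simp add: isCont_def tendsto_at_iff_tendsto_nhds)
  have "open {v::complex^3. v \<noteq> 0}" by (simp add: open_Collect_neq)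
  then have "(abs_cp2 \<longlongrightarrow> abs_cp2 (a y)) (nhds (a y))"
    using continuous_on_abs_cp2 \<open>a y \<noteq> 0\<close>
    by (simp add: continuous_on_eq_continuous_at isCont_def tendsto_at_iff_tendsto_nhds)
  then have "((\<lambda>y. abs_cp2 (a y)) \<longlongrightarrow> abs_cp2 (a y)) (nhds y)"
    using a by (rule filterlim_compose)
  moreover have "(affine_point i \<longlongrightarrow> affine_point i y) (nhds y)"
    using continuous_on_affine_point[of UNIV i]
    by (simp add: continuous_on_eq_continuous_at isCont_def tendsto_at_iff_tendsto_nhds del: split_paired_All)
  ultimately have "((\<lambda>y. (affine_point i y, abs_cp2 (a y))) \<longlongrightarrow> (affine_point i y, abs_cp2 (a y))) (nhds y)"
    by (intro tendsto_Pair)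
  then have "\<forall>\<^sub>F y' in nhds y. (affine_point i y', abs_cp2 (a y')) \<in> Q"
    by (rule topological_tendstoD) (use Q \<eta>(3) in \<open>auto simp: a_def\<close>)
  moreover have "\<forall>\<^sub>F y' in nhds y. y' \<in> U" using y flattensD(1)[OF fl] by (rule eventually_nhds_in_open[rotated])
  ultimately have "\<forall>\<^sub>F y' in nhds y. (affine_point i y', abs_cp2 (a y')) \<in> Q \<and> y' \<in> U" by (rule eventually_conj)
  then obtain B where B: "open B" "y \<in> B" "\<And>y'. y' \<in> B \<Longrightarrow> (affine_point i y', abs_cp2 (a y')) \<in> Q \<and> y' \<in> U"
    by (auto simp: eventually_nhds)
  show ?thesis
  proof (rule that[OF B(1,2)])
    show "B \<subseteq> U" using B(3) by blast
    show "\<exists>d'. (affine_point i y', d') \<in> lift N \<inter> Q" if "y' \<in> B" "affine_point i y' \<in> N" for y'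
      using lift_pullback(2)[OF that(2) _ \<eta>(1,2)] B(3)[OF that(1)] by (auto simp: a_def)
  qed
qed

end

section \<open>The dual of a generic germ\<close>

lemma open_vimage_chart:
  assumes "open B"
  shows "open {z. affine_dom i z \<and> affine_coord i z \<in> B}"
proof -
  have "{z. affine_dom i z \<and> affine_coord i z \<in> B} = {z. affine_dom i z} \<inter> affine_coord i -` B" by auto
  then show ?thesis
    using continuous_open_preimage[OF continuous_on_affine_coord open_affine_dom assms] by simp
qed

lemma open_vimage_chart2:
  assumes "open B"
  shows "open {p. affine_dom i (fst p) \<and> affine_dom j (snd p) \<and> (affine_coord i (fst p), affine_coord j (snd p)) \<in> B}"
proof -
  let ?D = "{z. affine_dom i z} \<times> {d. affine_dom j d}"
  have "continuous_on ?D (\<lambda>p. (affine_coord i (fst p), affine_coord j (snd p)))"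
    by (intro continuous_on_Pair continuous_on_compose2[OF continuous_on_affine_coord] continuous_on_fst continuous_on_snd continuous_on_id) auto
  from continuous_open_preimage[OF this open_Times[OF open_affine_dom open_affine_dom] assms]
  have "open (?D \<inter> (\<lambda>p. (affine_coord i (fst p), affine_coord j (snd p))) -` B)" .
  moreover have "?D \<inter> (\<lambda>p. (affine_coord i (fst p), affine_coord j (snd p))) -` B =
    {p. affine_dom i (fst p) \<and> affine_dom j (snd p) \<and> (affine_coord i (fst p), affine_coord j (snd p)) \<in> B}"
    by auto
  ultimately show ?thesis by simp
qed

lemma open_vimage_affine_point2:
  assumes "open W"
  shows "open {p. (affine_point i (fst p), affine_point j (snd p)) \<in> W}"
proof -
  have "continuous_on UNIV (\<lambda>p. (affine_point i (fst p), affine_point j (snd p)))"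
    by (intro continuous_on_Pair continuous_on_compose2[OF continuous_on_affine_point[of UNIV]] continuous_on_fst continuous_on_snd continuous_on_id) auto
  from open_vimage[OF assms this] show ?thesis by (simp add: vimage_def)
qed

text \<open>
  Submanifold and immersion properties are given in possibly different charts \<open>a\<close>, \<open>b\<close> and \<open>a'\<close>, \<open>b'\<close>.
  The tangent space of the lift is described in charts \<open>c\<close>, \<open>b\<close> with \<open>c\<close> arbitrary, because the chart that
  straightens \<open>N\<close> need not be \<open>a\<close>, whereas the tangent space of \<open>M\<close> is to be read in the chart in which
  \<open>M\<close> is straightened.
\<close>

lemma dual_of_generic:
  assumes gen: "generic_at N z d" and Q: "open Q" "(z, d) \<in> Q"
  obtains W M b j where "open W" "(z, d) \<in> W" "W \<subseteq> Q" "M = snd ` (lift N \<inter> W)"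
    "\<And>p. p \<in> W \<Longrightarrow> affine_dom b (snd p)"
    "submanifold_at cp2_atlas 1 j M d"
    "\<And>W'. open W' \<Longrightarrow> (z, d) \<in> W' \<Longrightarrow> W' \<subseteq> W \<Longrightarrow> germ_eq d (snd ` (lift N \<inter> W')) M"
    "\<And>z' d' c R. (z', d') \<in> lift N \<inter> W \<Longrightarrow> affine_dom c z' \<Longrightarrow>
      R = tangent_in (chart2 c b) (lift N) (z', d') \<Longrightarrow>
      subspace R \<and> dim R = j \<and> dim (snd ` R) = j \<and> tangent_in (chart b) M d' = snd ` R"
proof -
  obtain j a b where ab: "affine_dom a z" "affine_dom b d"
    and sub: "eucl_submanifold_at 1 j (snd (chart2 a b) ` (lift N \<inter> fst (chart2 a b))) (affine_coord a z, affine_coord b d)"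
    using gen unfolding generic_at_def submanifold_at_def prod_atlas_eq by auto
  obtain a' b' where ab': "affine_dom a' z" "affine_dom b' d"
    and inj': "inj_on snd (tangent_in (chart2 a' b') (lift N) (z, d))"
    using gen unfolding generic_at_def prod_atlas_eq by auto
  define P where "P = snd (chart2 a b) ` (lift N \<inter> fst (chart2 a b))"
  let ?x = "(affine_coord a z, affine_coord b d)"
  have P_iff: "(w, u) \<in> P \<longleftrightarrow> (affine_point a w, affine_point b u) \<in> lift N" for w u
  proof
    assume "(affine_point a w, affine_point b u) \<in> lift N"
    then show "(w, u) \<in> P" unfolding P_def by (intro image_eqI[of _ _ "(affine_point a w, affine_point b u)"]) auto
  qed (auto simp: P_def)
  have P_I: "(affine_coord a z', affine_coord b d') \<in> P" if "(z', d') \<in> lift N" "affine_dom a z'" "affine_dom b d'" for z' d'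
    using that by (simp add: P_iff)
  obtain D E where DE: "linear D" "bij D" "linear E" "bij E"
    "\<And>S. tangent_in (chart2 a' b') S (z, d) = map_prod D E ` tangent_in (chart2 a b) S (z, d)"
    using tangent_in_transition2[OF ab(1) ab'(1) ab(2) ab'(2)] by metis
  have "inj_on snd (eucl_tangent P ?x)"
  proof (rule inj_onI)
    fix p q assume pq: "p \<in> eucl_tangent P ?x" "q \<in> eucl_tangent P ?x" "snd p = snd q"
    have "eucl_tangent P ?x = tangent_in (chart2 a b) (lift N) (z, d)" by (simp add: tangent_in_def P_def)
    then have "map_prod D E p = map_prod D E q"
      using inj_onD[OF inj', of "map_prod D E p" "map_prod D E q"] pq by (simp add: DE(5))
    then have "D (fst p) = D (fst q)" by (metis fst_map_prod)
    then show "p = q" using pq(3) DE(2) by (metis bij_is_inj inj_eq prod_eq_iff)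
  qed
  moreover have "open {p. (affine_point a (fst p), affine_point b (snd p)) \<in> Q}" "?x \<in> {p. (affine_point a (fst p), affine_point b (snd p)) \<in> Q}"
    using open_vimage_affine_point2[OF Q(1)] Q(2) ab by auto
  ultimately obtain W0 where W0: "open W0" "?x \<in> W0" "W0 \<subseteq> {p. (affine_point a (fst p), affine_point b (snd p)) \<in> Q}"
    "eucl_submanifold_at 1 j (snd ` (P \<inter> W0)) (snd ?x)"
    "\<And>p. p \<in> P \<inter> W0 \<Longrightarrow> eucl_tangent (snd ` (P \<inter> W0)) (snd p) = snd ` eucl_tangent P p"
    "\<And>p. p \<in> P \<inter> W0 \<Longrightarrow> subspace (eucl_tangent P p)"
    "\<And>p. p \<in> P \<inter> W0 \<Longrightarrow> dim (eucl_tangent P p) = j"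
    "\<And>p. p \<in> P \<inter> W0 \<Longrightarrow> dim (snd ` eucl_tangent P p) = j"
    "\<And>W'. open W' \<Longrightarrow> ?x \<in> W' \<Longrightarrow>
      \<exists>B. open B \<and> snd ?x \<in> B \<and> snd ` (P \<inter> W0) \<inter> B \<subseteq> snd ` (P \<inter> W')"
    by (rule immersed_projection[OF sub[folded P_def]]) blast
  define W where "W = {p. affine_dom a (fst p) \<and> affine_dom b (snd p) \<and> (affine_coord a (fst p), affine_coord b (snd p)) \<in> W0}"
  define M where "M = snd ` (lift N \<inter> W)"
  have M_eq: "chart_image b M = snd ` (P \<inter> W0)"
  proof (intro subset_antisym subsetI)
    fix u assume "u \<in> chart_image b M"
    then obtain z' d' where zd: "(z', d') \<in> lift N" "(z', d') \<in> W" "u = affine_coord b d'"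
      by (auto simp: M_def)
    then have "(affine_coord a z', affine_coord b d') \<in> P \<inter> W0" using P_I by (simp add: W_def)
    then show "u \<in> snd ` (P \<inter> W0)" using zd(3) by (intro image_eqI) auto
  next
    fix u assume "u \<in> snd ` (P \<inter> W0)"
    then obtain w where w: "(w, u) \<in> P" "(w, u) \<in> W0" by auto
    then have "(affine_point a w, affine_point b u) \<in> lift N \<inter> W" by (simp add: P_iff W_def)
    then have "affine_point b u \<in> M" unfolding M_def by (intro image_eqI) auto
    then show "u \<in> chart_image b M" by (simp only: chart_image_iff)
  qed
  show ?thesis
  proof (rule that[of W M b j])
    show "open W" unfolding W_def by (rule open_vimage_chart2[OF W0(1)])
    show "(z, d) \<in> W" using W0(2) ab by (simp add: W_def)
    show "W \<subseteq> Q"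
    proof clarify
      fix z' d' assume "(z', d') \<in> W"
      then show "(z', d') \<in> Q" using W0(3) by (force simp: W_def)
    qed
    show "M = snd ` (lift N \<inter> W)" by (rule M_def)
    show "affine_dom b (snd p)" if "p \<in> W" for p using that by (simp add: W_def)
    show "submanifold_at cp2_atlas 1 j M d"
      unfolding submanifold_at_def cp2_atlas_eq using ab(2) W0(4) M_eq by (auto intro!: bexI[of _ "chart b"])
  next
    fix W' assume W': "open W'" "(z, d) \<in> W'" "W' \<subseteq> W"
    have "open {p. (affine_point a (fst p), affine_point b (snd p)) \<in> W'}" "?x \<in> {p. (affine_point a (fst p), affine_point b (snd p)) \<in> W'}"
      using open_vimage_affine_point2[OF W'(1)] W'(2) ab by auto
    then obtain B where B: "open B" "affine_coord b d \<in> B"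
      "snd ` (P \<inter> W0) \<inter> B \<subseteq> snd ` (P \<inter> {p. (affine_point a (fst p), affine_point b (snd p)) \<in> W'})"
      using W0(9) by force
    let ?B = "{d. affine_dom b d \<and> affine_coord b d \<in> B}"
    have "M \<inter> ?B \<subseteq> snd ` (lift N \<inter> W')"
    proof
      fix d' assume d': "d' \<in> M \<inter> ?B"
      then have "affine_coord b d' \<in> snd ` (P \<inter> W0) \<inter> B" unfolding M_eq[symmetric] by auto
      then obtain w where "(w, affine_coord b d') \<in> P" "(affine_point a w, affine_point b (affine_coord b d')) \<in> W'"
        using B(3) by force
      then have "(affine_point a w, d') \<in> lift N \<inter> W'" using d' by (simp add: P_iff)
      then show "d' \<in> snd ` (lift N \<inter> W')" by (intro image_eqI) auto
    qed
    moreover have "snd ` (lift N \<inter> W') \<subseteq> M" using W'(3) by (auto simp: M_def)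
    ultimately show "germ_eq d (snd ` (lift N \<inter> W')) M"
      unfolding germ_eq_def using open_vimage_chart[OF B(1), of b] B(2) ab(2) by (intro exI[of _ ?B]) blast
  next
    fix z' d' c R assume zd: "(z', d') \<in> lift N \<inter> W" and c: "affine_dom c z'"
      and R: "R = tangent_in (chart2 c b) (lift N) (z', d')"
    let ?R0 = "tangent_in (chart2 a b) (lift N) (z', d')" and ?p = "(affine_coord a z', affine_coord b d')"
    have dom: "affine_dom a z'" "affine_dom b d'" and p: "?p \<in> P \<inter> W0"
      using zd P_I by (auto simp: W_def)
    have R0: "?R0 = eucl_tangent P ?p" by (simp add: tangent_in_def P_def)
    obtain D E where DE: "linear D" "bij D" "E = id"
      "\<And>S. tangent_in (chart2 c b) S (z', d') = map_prod D E ` tangent_in (chart2 a b) S (z', d')"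
      using tangent_in_transition2[OF dom(1) c dom(2) dom(2)] by metis
    have R': "R = map_prod D id ` ?R0" by (simp only: R DE(3,4))
    have lin: "linear (map_prod D id :: _ \<Rightarrow> (complex \<times> complex) \<times> complex \<times> complex)"
      by (rule linearI) (auto simp: linear_add[OF DE(1)] linear_cmul[OF DE(1)] prod_eq_iff fst_map_prod snd_map_prod)
    have "inj (map_prod D (id :: complex \<times> complex \<Rightarrow> _))" using DE(2) by (simp add: bij_def prod.inj_map)
    then have "dim R = dim ?R0" unfolding R' by (intro dim_image_eq[OF lin]) (rule inj_on_subset, auto)
    moreover have "snd ` R = snd ` ?R0" unfolding R' by (simp add: image_image snd_map_prod)
    moreover have "subspace R" unfolding R' by (rule linear_subspace_image[OF lin]) (simp add: R0 W0(6)[OF p])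
    moreover have "tangent_in (chart b) M d' = snd ` ?R0"
      using W0(5)[OF p] M_eq by (simp add: tangent_in_def[of "chart b"] R0)
    ultimately show "subspace R \<and> dim R = j \<and> dim (snd ` R) = j \<and> tangent_in (chart b) M d' = snd ` R"
      using W0(7,8)[OF p] R0 by simp
  qed
qed

text \<open>The second equation is the derivative of the incidence relation along the lift.\<close>

lemma contact_relation:
  assumes dom: "affine_dom i z" "affine_dom j d" and wu: "(w, u) \<in> tangent_in (chart2 i j) (lift N) (z, d)"
  shows "w \<in> tangent_in (chart i) N z"
    "pairing (dhomog i w) (homog j (affine_coord j d)) = - pairing (dhomog j u) (homog i (affine_coord i z))"
proof -
  let ?P = "map_prod (affine_coord i) (affine_coord j) ` (lift N \<inter> {z. affine_dom i z} \<times> {z. affine_dom j z})"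
  let ?y = "affine_coord i z" and ?v = "affine_coord j d"
  have wu': "(w, u) \<in> eucl_tangent ?P (?y, ?v)" using wu by (simp add: tangent_in_def)
  have "fst ` eucl_tangent ?P (?y, ?v) \<subseteq> eucl_tangent (chart_image i N) (fst (?y, ?v))"
    by (rule eucl_tangent_image_subset[where W = UNIV])
      (auto intro!: derivative_eq_intros simp: lift_def)
  then show "w \<in> tangent_in (chart i) N z" using wu' by (force simp: tangent_in_def)
  define g where "g q = pairing (homog i (fst q)) (homog j (snd q))" for q
  have dg: "(g has_derivative (\<lambda>h. pairing (homog i ?y) (dhomog j (snd h)) + pairing (dhomog i (fst h)) (homog j ?v))) (at (?y, ?v))"
    using bounded_bilinear.FDERIV[OF bounded_bilinear_pairing
      has_derivative_compose[OF has_derivative_fst[OF has_derivative_ident] homog_has_derivative[of i]]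
      has_derivative_compose[OF has_derivative_snd[OF has_derivative_ident] homog_has_derivative[of j]], of "(?y, ?v)" UNIV]
    by (simp add: g_def[abs_def])
  have "g ` (?P \<inter> UNIV) \<subseteq> {0}"
  proof clarsimp
    fix z d assume "(z, d) \<in> lift N" "affine_dom i z" "affine_dom j d"
    then have "incident (affine_point i (affine_coord i z)) (affine_point j (affine_coord j d))"
      by (simp add: lift_def flag_variety_def line_def)
    then show "g (affine_coord i z, affine_coord j d) = 0" by (simp add: g_def affine_point_def incident_abs)
  qed
  from eucl_tangent_image_subset[OF dg open_UNIV UNIV_I this]
  have "pairing (homog i ?y) (dhomog j u) + pairing (dhomog i w) (homog j ?v) \<in> eucl_tangent {0} (g (?y, ?v))"
    using wu' by force
  moreover have "g (?y, ?v) = 0 \<Longrightarrow> eucl_tangent {0} (g (?y, ?v)) = {0}"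
    using eucl_tangent_subspace[of "{0::complex}" UNIV 0] by simp
  moreover have "g (?y, ?v) = 0" using eucl_tangent_nonempty calculation(1) by blast
  ultimately have "pairing (homog i ?y) (dhomog j u) + pairing (dhomog i w) (homog j ?v) = 0" by auto
  then show "pairing (dhomog i w) (homog j ?v) = - pairing (dhomog j u) (homog i ?y)"
    by (simp add: pairing_commute[of "dhomog j u"] eq_neg_iff_add_eq_0 add.commute)
qed

text \<open>
  The conormality of lemma \<open>lift_iff_conormal\<close> for the normalized homogeneous vector of \<open>d\<close>, at the
  price of a complex factor. In this form it can be compared through lemma \<open>contact_relation\<close>.
\<close>

lemma conormal_scaled:
  assumes "(z, d) \<in> lift N" "affine_dom i z" "affine_dom j d" "subspace (tangent_in (chart i) N z)"
  obtains l where "l \<noteq> 0" "pairing (homog i (affine_coord i z)) (homog j (affine_coord j d)) = 0"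
    "\<And>w. w \<in> tangent_in (chart i) N z \<Longrightarrow> Re (l * pairing (dhomog i w) (homog j (affine_coord j d))) = 0"
proof -
  obtain a where a: "a \<noteq> 0" "d = abs_cp2 a" "pairing (homog i (affine_coord i z)) a = 0"
    "\<forall>w\<in>tangent_in (chart i) N z. Re (pairing (dhomog i w) a) = 0"
    using assms(1) unfolding lift_iff_conormal[OF assms(2,4)] by blast
  have aj: "a $ j \<noteq> 0" using assms(3) affine_dom_abs[OF a(1)] a(2) by simp
  have h: "homog j (affine_coord j d) = inverse (a $ j) *s a" unfolding a(2) by (rule homog_affine_coord[OF a(1) aj])
  show ?thesis by (rule that[of "a $ j"]) (use aj a(3,4) in \<open>simp_all add: h\<close>)
qed

text \<open>
  If \<open>l\<close> times the vector of \<open>d\<close> is conormal to \<open>N\<close>, then \<open>l\<close> times the vector of \<open>z\<close> is conormal to \<open>M\<close>, by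
  the contact relation.
\<close>

lemma lift_swap:
  assumes l: "(z, d) \<in> lift N" and dom: "affine_dom i z" "affine_dom j d"
    and T: "subspace (tangent_in (chart i) N z)" and S: "subspace (tangent_in (chart j) M d)"
    and d: "d \<in> M" and sub: "tangent_in (chart j) M d \<subseteq> snd ` tangent_in (chart2 i j) (lift N) (z, d)"
  shows "(d, z) \<in> lift M"
proof -
  let ?y = "affine_coord i z" and ?v = "affine_coord j d"
  obtain l where l: "l \<noteq> 0" "pairing (homog i ?y) (homog j ?v) = 0"
    "\<And>w. w \<in> tangent_in (chart i) N z \<Longrightarrow> Re (l * pairing (dhomog i w) (homog j ?v)) = 0"
    using conormal_scaled[OF l dom T] by metis
  have "l *s homog i ?y \<noteq> 0" using l(1) by (metis homog_nth(1) mult_cancel_left1 vector_smult_component zero_index)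
  moreover have "z = abs_cp2 (l *s homog i ?y)"
    using abs_cp2_eq_iff[OF homog_neq_0 calculation] dom(1) affine_point_affine_coord[OF dom(1)] unfolding affine_point_def by metis
  moreover have "pairing (homog j ?v) (l *s homog i ?y) = 0" using l(2) by (simp add: pairing_commute)
  moreover have "Re (pairing (dhomog j u) (l *s homog i ?y)) = 0" if u: "u \<in> tangent_in (chart j) M d" for u
  proof -
    obtain w where "(w, u) \<in> tangent_in (chart2 i j) (lift N) (z, d)" using sub u by force
    from contact_relation[OF dom this] l(3)[of w] show ?thesis by simp
  qed
  ultimately show ?thesis unfolding lift_iff_conormal[OF dom(2) S] using d by blast
qed

lemma dim_kernel_le_2:
  assumes v: "v \<noteq> 0" "pairing (homog j u) v = 0"
  shows "dim {w. pairing (dhomog j w) v = 0} \<le> 2"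
proof -
  obtain e where "pairing (dhomog j e) v = 1" using exists_dhomog_eq_1[OF v] .
  then have nz: "v $ (j + 1) \<noteq> 0 \<or> v $ (j + 2) \<noteq> 0" by (auto simp: pairing_dhomog)
  let ?k = "(- v $ (j + 2), v $ (j + 1))" and ?ik = "(\<i> * - v $ (j + 2), \<i> * v $ (j + 1))"
  have "{w. pairing (dhomog j w) v = 0} \<subseteq> span {?k, ?ik}"
  proof clarify
    fix w1 w2 assume "pairing (dhomog j (w1, w2)) v = 0"
    then have 0: "v $ (j + 1) * w1 + v $ (j + 2) * w2 = 0" by (simp add: pairing_dhomog)
    obtain c where c: "w1 = c * - v $ (j + 2)" "w2 = c * v $ (j + 1)"
    proof (cases "v $ (j + 1) = 0")
      case False
      have "v $ (j + 1) * w1 = - (v $ (j + 2) * w2)" using 0 by (simp add: eq_neg_iff_add_eq_0)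
      then have "w1 = - (v $ (j + 2) * w2) / v $ (j + 1)" using False by (simp add: field_simps)
      then show ?thesis using that[of "w2 / v $ (j + 1)"] False by simp
    next
      case True
      then show ?thesis using that[of "- w1 / v $ (j + 2)"] nz 0 by simp
    qed
    have "(w1, w2) = Re c *\<^sub>R ?k + Im c *\<^sub>R ?ik"
      unfolding c by (simp add: complex_eq_iff)
    also have "\<dots> \<in> span {?k, ?ik}" by (intro span_add span_scale span_base) auto
    finally show "(w1, w2) \<in> span {?k, ?ik}" .
  qed
  then have "dim {w. pairing (dhomog j w) v = 0} \<le> card {?k, ?ik}" by (rule dim_le_card) simp
  also have "\<dots> \<le> 2" by (simp add: card_insert_if)
  finally show ?thesis .
qed

text \<open>
  The kernel of \<open>v\<close> is stable under multiplication by \<open>\<i>\<close>. So a covector that is conormal to a set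
  whose tangent space contains this kernel vanishes on the kernel, as a complex functional.
\<close>

lemma unique_lift_point:
  assumes v: "v \<noteq> 0" "pairing (homog j (affine_coord j d)) v = 0" and d: "affine_dom j d"
    and S: "subspace (tangent_in (chart j) M d)"
    and ker: "\<And>u. pairing (dhomog j u) v = 0 \<Longrightarrow> u \<in> tangent_in (chart j) M d" and l: "(d, z) \<in> lift M"
  shows "z = abs_cp2 v"
proof -
  obtain a where a: "a \<noteq> 0" "z = abs_cp2 a" "pairing (homog j (affine_coord j d)) a = 0"
    "\<forall>u\<in>tangent_in (chart j) M d. Re (pairing (dhomog j u) a) = 0"
    using l unfolding lift_iff_conormal[OF d S] by blast
  have "pairing (dhomog j u) a = 0" if "pairing (dhomog j u) v = 0" for u
  proof -
    have "pairing (dhomog j (\<i> * fst u, \<i> * snd u)) v = 0" using that by (simp add: dhomog_smult)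
    then have "Re (pairing (dhomog j (\<i> * fst u, \<i> * snd u)) a) = 0" "Re (pairing (dhomog j u) a) = 0"
      using a(4) ker that by blast+
    then show ?thesis by (simp add: dhomog_smult complex_eq_iff)
  qed
  then obtain c where "a = c *s v" using proportional_of_kernel[OF v a(3)] by metis
  then show ?thesis using abs_cp2_eq_iff[OF v(1) a(1)] a(2) by metis
qed

theorem mainTheorem3:
  fixes N :: "cp2 set" and z0 d0 :: cp2 and k :: nat
  assumes "k \<le> 3"
    and "submanifold_at cp2_atlas 2 k N z0"
    and "(z0, d0) \<in> lift N"
    and "generic_at N z0 d0"
  shows "\<exists>M. is_dual_germ N z0 d0 M \<and>
             (\<exists>j\<le>3. submanifold_at cp2_atlas 1 j M d0) \<and>
             (d0, z0) \<in> lift M \<and> is_dual_germ M d0 z0 N"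
proof -
  obtain i where i: "affine_dom i z0" "eucl_submanifold_at 2 k (chart_image i N) (affine_coord i z0)"
    using assms(2) unfolding submanifold_at_def cp2_atlas_eq by auto
  then obtain U V \<Phi> \<Psi> L where U: "affine_coord i z0 \<in> U" and fl: "flattens 2 (chart_image i N) U V \<Phi> \<Psi> L"
    unfolding eucl_submanifold_at_flattens by blast
  define Q where "Q = {z. affine_dom i z \<and> affine_coord i z \<in> U} \<times> (UNIV :: cp2 set)"
  have "open Q" unfolding Q_def using open_vimage_chart[OF flattensD(1)[OF fl]] by (intro open_Times) auto
  moreover have "(z0, d0) \<in> Q" using i(1) U by (simp add: Q_def)
  ultimately obtain W M b j where W: "open W" "(z0, d0) \<in> W" "W \<subseteq> Q" "M = snd ` (lift N \<inter> W)"
    "\<And>p. p \<in> W \<Longrightarrow> affine_dom b (snd p)"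
    "submanifold_at cp2_atlas 1 j M d0"
    "\<And>W'. open W' \<Longrightarrow> (z0, d0) \<in> W' \<Longrightarrow> W' \<subseteq> W \<Longrightarrow> germ_eq d0 (snd ` (lift N \<inter> W')) M"
    "\<And>z' d' c R. (z', d') \<in> lift N \<inter> W \<Longrightarrow> affine_dom c z' \<Longrightarrow>
      R = tangent_in (chart2 c b) (lift N) (z', d') \<Longrightarrow>
      subspace R \<and> dim R = j \<and> dim (snd ` R) = j \<and> tangent_in (chart b) M d' = snd ` R"
    using dual_of_generic[OF assms(4)] by metis
  have facts: "(d, z) \<in> lift M" "j \<le> 3" "\<And>z'. (d, z') \<in> lift M \<Longrightarrow> z' = z"
    if zd: "(z, d) \<in> lift N" "(z, d) \<in> W" for z d
  proof -
    let ?y = "affine_coord i z" and ?v = "affine_coord b d"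
      and ?R = "tangent_in (chart2 i b) (lift N) (z, d)" and ?S = "tangent_in (chart b) M d"
    have dom: "affine_dom i z" "affine_coord i z \<in> U" "affine_dom b d"
      using zd W(3) W(5)[OF zd(2)] by (auto simp: Q_def)
    have zN: "z \<in> N" using zd(1) by (simp add: lift_def)
    have dM: "d \<in> M" unfolding W(4) using zd by (intro image_eqI[of _ _ "(z, d)"]) auto
    have T: "subspace (tangent_in (chart i) N z)" using tangent_in_flattens(2)[OF fl zN dom(1,2)] .
    have R: "subspace ?R" "dim ?R = j" "dim (snd ` ?R) = j" "?S = snd ` ?R"
      using W(8)[OF _ dom(1) refl] zd by auto
    have S: "subspace ?S" "dim ?S = j" unfolding R(4) using R(3) linear_subspace_image[OF linear_snd R(1)] by auto
    show dz: "(d, z) \<in> lift M" by (rule lift_swap[OF zd(1) dom(1,3) T S(1) dM]) (simp add: R(4))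
    obtain l where l: "l \<noteq> 0" "pairing (homog b ?v) (homog i ?y) = 0"
      "\<And>u. u \<in> ?S \<Longrightarrow> Re (l * pairing (dhomog b u) (homog i ?y)) = 0"
      using conormal_scaled[OF dz dom(3,1) S(1)] by metis
    have zd': "(affine_point i ?y, d) \<in> lift N" and R': "tangent_in (chart2 i b) (lift N) (affine_point i ?y, d) \<subseteq> ?R"
      using zd(1) dom(1) by simp_all
    have rank: "2 \<le> j" "j = 2 \<Longrightarrow> w \<in> tangent_in (chart i) N z \<Longrightarrow> pairing (dhomog i w) (homog b ?v) = 0" for w
      using lift_rank[OF fl zd' dom(2,3) R'] dom(1) R(2) by simp_all
    let ?H = "{u. Re (l * pairing (dhomog b u) (homog i ?y)) = 0}" and ?K = "{u. pairing (dhomog b u) (homog i ?y) = 0}"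
    have H: "subspace ?H" and K: "subspace ?K"
      by (rule subspaceI; auto simp: linear_0[OF linear_dhomog] linear_add[OF linear_dhomog] linear_cmul[OF linear_dhomog] distrib_left)+
    obtain e where e: "pairing (dhomog b e) (homog i ?y) = 1" using exists_dhomog_eq_1[OF homog_neq_0 l(2)] .
    have "pairing (dhomog b (inverse l * fst e, inverse l * snd e)) (homog i ?y) = inverse l"
      using e by (simp add: dhomog_smult)
    then have "l * pairing (dhomog b (inverse l * fst e, inverse l * snd e)) (homog i ?y) = 1" using l(1) by simp
    then have "(inverse l * fst e, inverse l * snd e) \<notin> ?H"
      by (metis (mono_tags, lifting) mem_Collect_eq one_complex.sel(1) zero_neq_one)
    then have "?H \<noteq> UNIV" by blast
    then have "dim ?H \<noteq> DIM(complex \<times> complex)" unfolding dim_eq_full span_eq_iff[THEN iffD2, OF H] .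
    then have dimH: "dim ?H \<le> 3" using dim_subset_UNIV[of ?H] by simp
    have SH: "?S \<subseteq> ?H" using l(3) by blast
    then show "j \<le> 3" using dim_subset[OF SH] S(2) dimH by simp
    have KS: "?K \<subseteq> ?S"
    proof (cases "j = 2")
      case True
      have "?S \<subseteq> ?K"
      proof
        fix u assume "u \<in> ?S"
        then obtain w where "(w, u) \<in> ?R" unfolding R(4) by force
        from contact_relation[OF dom(1,3) this] rank(2)[OF True] show "u \<in> ?K" by simp
      qed
      moreover have "dim ?K \<le> dim ?S" using dim_kernel_le_2[OF homog_neq_0 l(2)] S(2) True by simp
      ultimately have "?S = ?K" by (rule subspace_dim_equal[OF S(1) K])
      then show ?thesis by (simp only: order_refl)
    next
      case False
      then have "dim ?H \<le> dim ?S" using dimH S(2) rank(1) by simp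
      then have "?S = ?H" by (rule subspace_dim_equal[OF S(1) H SH])
      moreover have "?K \<subseteq> ?H"
      proof clarify
        fix u assume "pairing (dhomog b u) (homog i ?y) = 0"
        then show "Re (l * pairing (dhomog b u) (homog i ?y)) = 0" by (simp only: mult_zero_right zero_complex.sel)
      qed
      ultimately show ?thesis by (simp only:)
    qed
    show "z' = z" if "(d, z') \<in> lift M" for z'
    proof -
      have "z' = abs_cp2 (homog i ?y)"
        by (rule unique_lift_point[OF homog_neq_0 l(2) dom(3) S(1) _ that]) (use KS in blast)
      then show ?thesis using dom(1) by (simp add: affine_point_def[symmetric])
    qed
  qed
  have "is_dual_germ N z0 d0 M"
    unfolding is_dual_germ_def germ_image_def using W(1,2,7) by auto
  moreover have "is_dual_germ M d0 z0 N"
    unfolding is_dual_germ_def germ_image_def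
  proof (intro exI[of _ "prod.swap -` W"] conjI allI impI)
    have swap: "continuous_on UNIV (prod.swap :: cp2 \<times> cp2 \<Rightarrow> _)"
      unfolding prod.swap_def by (intro continuous_on_Pair continuous_on_fst continuous_on_snd continuous_on_id)
    show "open (prod.swap -` W)" by (rule open_vimage[OF W(1) swap])
    show "(d0, z0) \<in> prod.swap -` W" using W(2) by simp
    fix W' assume W': "open W' \<and> (d0, z0) \<in> W' \<and> W' \<subseteq> prod.swap -` W"
    then have "open (prod.swap -` W')" using open_vimage[OF _ swap] by blast
    moreover have "(affine_point i (affine_coord i z0), d0) \<in> prod.swap -` W'" "(affine_point i (affine_coord i z0), d0) \<in> lift N"
      using W' i(1) assms(3) by simp_all
    ultimately obtain B where B: "open B" "affine_coord i z0 \<in> B" "B \<subseteq> U"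
      "\<And>y. y \<in> B \<Longrightarrow> affine_point i y \<in> N \<Longrightarrow> \<exists>d. (affine_point i y, d) \<in> lift N \<inter> prod.swap -` W'"
      using lift_section[OF fl _ U] by metis
    let ?B = "{z. affine_dom i z \<and> affine_coord i z \<in> B}"
    have "snd ` (lift M \<inter> W') \<subseteq> N"
    proof clarsimp
      fix d z assume dz: "(d, z) \<in> lift M" "(d, z) \<in> W'"
      then have "d \<in> M" by (simp add: lift_def)
      then obtain z' where z': "(z', d) \<in> lift N" "(z', d) \<in> W" using W(4) by auto
      with facts(3)[OF z' dz(1)] show "z \<in> N" by (simp add: lift_def)
    qed
    moreover have "N \<inter> ?B \<subseteq> snd ` (lift M \<inter> W')"
    proof
      fix z assume z: "z \<in> N \<inter> ?B"
      then obtain d where d: "(z, d) \<in> lift N" "(d, z) \<in> W'" using B(4)[of "affine_coord i z"] by auto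
      then have "(d, z) \<in> lift M" using facts(1) W' by auto
      with d show "z \<in> snd ` (lift M \<inter> W')" by (intro image_eqI) auto
    qed
    ultimately show "germ_eq (snd (d0, z0)) (snd ` (lift M \<inter> W')) N"
      unfolding germ_eq_def using open_vimage_chart[OF B(1), of i] B(2) i(1) by (intro exI[of _ ?B]) auto
  qed
  ultimately show ?thesis using facts(1,2)[OF assms(3) W(2)] W(6) by blast
qed

end
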